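(* There exist two non-degenerate probability measures $\mu_1,\mu_2$ on the subset $S=\{a,b,\bar b,ba,\bar b a\}$ of the group $\Gamma=\mathbb Z_2*\mathbb Z_3$ such that the corresponding harmonic measures $\nu_1$ and $\nu_2$ both belong to the Minkowski measure class on $\partial\Gamma$, whereas for every $0<t<1$ the harmonic measure $\nu$ of the convex combination $\mu=t\mu_1+(1-t)\mu_2$ is singular with respect to this measure class.
   Context: $\Gamma=\mathbb Z_2*\mathbb Z_3$ with $\mathbb Z_2=\langle a\mid a^2\rangle$, $\mathbb Z_3=\langle b\mid b^3\rangle$, $\bar b=b^{-1}=b^2$. Elements of $\Gamma$ are identified with finite words in $\{a,b,\bar b\}$ in which the letter $a$ and letters from $\{b,\bar b\}$ alternate. $\partial\Gamma$ is the set of right-infinite words in $\{a,b,\bar b\}$ subject to the same alternation rule, with the topology induced by the product topology; $\Gamma$ acts on it on the left by concatenation followed, if necessary, by reduction. A sequence $g_n\in\Gamma$ converges to $\gamma\in\partial\Gamma$ if for every $k$ the first $k$ letters of $g_n$ coincide with those of $\gamma$ for all large $n$. A probability measure $\mu$ on $\Gamma$ is non-degenerate if its support generates $\Gamma$ as a semigroup. For a non-degenerate $\mu$ as in the claim, the sample paths $g_n=h_1\cdots h_n$ (with $h_i$ independent and $\mu$-distributed) of the random walk $(\Gamma,\mu)$ converge almost surely to $\partial\Gamma$; the distribution of the limit is the harmonic measure of $\mu$; it is the unique probability measure $\nu$ on $\partial\Gamma$ with $\nu=\sum_g\mu(g)\,g\nu$. For $0<\alpha<1$ let $\kappa^\alpha$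 be the distribution of the random infinite word $a\beta_1a\beta_2a\cdots$, where the $\beta_i$ are independent and take the values $b$ and $\bar b$ with probabilities $\alpha$ and $1-\alpha$. For $0<p<1$ put $\kappa^{\alpha,p}=p\,\kappa^\alpha+(1-p)\,a\kappa^\alpha$, where $a\kappa^\alpha$ is the image of $\kappa^\alpha$ under the action of $a$ (the distribution of $\beta_1a\beta_2a\cdots$). The Minkowski measure class is the common measure class of the measures $\kappa^{1/2,p}$, $0<p<1$. *)

theory Defs
  imports "HOL-Probability.Probability" "HOL-Algebra.Group"
begin

section \<open>The group and its boundary\<close>

datatype letter = La | Lb | Lbbar

instance letter :: countable
  by countable_datatype

abbreviation alternate :: "letter \<Rightarrow> letter \<Rightarrow> bool" where
  "alternate x y \<equiv> (x = La) \<noteq> (y = La)"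

definition reduced :: "letter list \<Rightarrow> bool" where
  "reduced w \<longleftrightarrow> (\<forall>i. Suc i < length w \<longrightarrow> alternate (w ! i) (w ! Suc i))"

definition boundary :: "letter stream set" where
  "boundary = {\<gamma>. \<forall>i. alternate (\<gamma> !! i) (\<gamma> !! Suc i)}"

text \<open>\<open>junction x y\<close> is the reduced word representing the product of two letters.\<close>

fun junction :: "letter \<Rightarrow> letter \<Rightarrow> letter list" where
  "junction La La = []"
| "junction Lb Lb = [Lbbar]"
| "junction Lbbar Lbbar = [Lb]"
| "junction Lb Lbbar = []"
| "junction Lbbar Lb = []"
| "junction x y = [x, y]"

fun letter_mult :: "letter \<Rightarrow> letter list \<Rightarrow> letter list" where
  "letter_mult x [] = [x]"
| "letter_mult x (y # w) = junction x y @ w"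

definition letter_act :: "letter \<Rightarrow> letter stream \<Rightarrow> letter stream" where
  "letter_act x \<gamma> = junction x (shd \<gamma>) @- stl \<gamma>"

text \<open>Concatenation followed by reduction, performed letter by letter from the right end
  of the left factor.\<close>

definition Gamma :: "letter list monoid" where
  "Gamma = \<lparr>carrier = {w. reduced w}, mult = (\<lambda>u v. foldr letter_mult u v), one = []\<rparr>"

definition act :: "letter list \<Rightarrow> letter stream \<Rightarrow> letter stream" where
  "act g \<gamma> = foldr letter_act g \<gamma>"

text \<open>As there are finitely many letters, the product sigma-algebra of \<open>stream_space\<close> is the
  Borel sigma-algebra of the product topology.\<close>

definition boundary_space :: "letter stream measure" where
  "boundary_space = restrict_space (stream_space (count_space UNIV)) boundary"

definition converges_to_boundary :: "(nat \<Rightarrow> letter list) \<Rightarrow> letter stream \<Rightarrow> bool" where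
  "converges_to_boundary g \<gamma> \<longleftrightarrow>
     (\<forall>k. \<forall>\<^sub>F n in sequentially. k \<le> length (g n) \<and> take k (g n) = stake k \<gamma>)"


section \<open>Random walks and harmonic measures\<close>

inductive_set semigroup_span :: "('a, 'm) monoid_scheme \<Rightarrow> 'a set \<Rightarrow> 'a set"
  for G :: "('a, 'm) monoid_scheme" and H :: "'a set" where
  incl: "h \<in> H \<Longrightarrow> h \<in> semigroup_span G H"
| mult: "g \<in> semigroup_span G H \<Longrightarrow> h \<in> semigroup_span G H \<Longrightarrow> g \<otimes>\<^bsub>G\<^esub> h \<in> semigroup_span G H"

definition non_degenerate :: "letter list pmf \<Rightarrow> bool" where
  "non_degenerate \<mu> \<longleftrightarrow> semigroup_span Gamma (set_pmf \<mu>) = carrier Gamma"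

fun sample_path :: "letter list stream \<Rightarrow> nat \<Rightarrow> letter list" where
  "sample_path h 0 = \<one>\<^bsub>Gamma\<^esub>"
| "sample_path h (Suc n) = sample_path h n \<otimes>\<^bsub>Gamma\<^esub> h !! n"

text \<open>\<open>is_harmonic_measure \<mu> \<nu>\<close> includes the almost sure convergence of the sample paths;
  \<open>\<nu>\<close> is determined by \<open>\<mu>\<close>, since limits are unique.\<close>

definition is_harmonic_measure :: "letter list pmf \<Rightarrow> letter stream measure \<Rightarrow> bool" where
  "is_harmonic_measure \<mu> \<nu> \<longleftrightarrow>
     (\<exists>Z \<in> measurable (stream_space (measure_pmf \<mu>)) boundary_space.
        (AE h in stream_space (measure_pmf \<mu>). converges_to_boundary (sample_path h) (Z h)) \<and>
        \<nu> = distr (stream_space (measure_pmf \<mu>)) boundary_space Z)"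

definition step_set :: "letter list set" where
  "step_set = {[La], [Lb], [Lbbar], [Lb, La], [Lbbar, La]}"

definition convex_comb_pmf :: "real \<Rightarrow> 'a pmf \<Rightarrow> 'a pmf \<Rightarrow> 'a pmf" where
  "convex_comb_pmf t \<mu>\<^sub>1 \<mu>\<^sub>2 = bind_pmf (bernoulli_pmf t) (\<lambda>c. if c then \<mu>\<^sub>1 else \<mu>\<^sub>2)"


section \<open>The Minkowski measure class\<close>

definition coin_word :: "bool stream \<Rightarrow> letter stream" where
  "coin_word \<omega> = flat (smap (\<lambda>c. [La, if c then Lb else Lbbar]) \<omega>)"

definition kappa :: "real \<Rightarrow> letter stream measure" where
  "kappa \<alpha> = distr (stream_space (measure_pmf (bernoulli_pmf \<alpha>))) boundary_space coin_word"

definition kappa_mix :: "real \<Rightarrow> real \<Rightarrow> letter stream measure" where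
  "kappa_mix \<alpha> p = measure_of (space boundary_space) (sets boundary_space)
     (\<lambda>A. ennreal p * emeasure (kappa \<alpha>) A
        + ennreal (1 - p) * emeasure (distr (kappa \<alpha>) boundary_space (act [La])) A)"

definition equivalent_measures :: "'a measure \<Rightarrow> 'a measure \<Rightarrow> bool" where
  "equivalent_measures M N \<longleftrightarrow>
     sets M = sets N \<and> absolutely_continuous M N \<and> absolutely_continuous N M"

definition mutually_singular :: "'a measure \<Rightarrow> 'a measure \<Rightarrow> bool" where
  "mutually_singular M N \<longleftrightarrow> sets M = sets N \<and>
     (\<exists>A \<in> sets M. emeasure M A = 0 \<and> emeasure N (space N - A) = 0)"

definition minkowski_class :: "letter stream measure set" where
  "minkowski_class = {m. \<forall>p. 0 < p \<and> p < 1 \<longrightarrow> equivalent_measures m (kappa_mix (1/2) p)}"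

definition singular_to_class :: "'a measure \<Rightarrow> 'a measure set \<Rightarrow> bool" where
  "singular_to_class \<nu> C \<longleftrightarrow> (\<forall>m \<in> C. mutually_singular \<nu> m)"


section \<open>Basic facts about the definitions\<close>

lemma reduced_Nil: "reduced []"
  by (simp add: reduced_def)

lemma reduced_Cons: "reduced (x # w) \<longleftrightarrow> (w = [] \<or> alternate x (hd w)) \<and> reduced w"
  unfolding reduced_def by (cases w) (auto simp: nth_Cons split: nat.splits)

lemma letter_mult_reduced: "reduced w \<Longrightarrow> reduced (letter_mult x w)"
  by (cases w; cases x; cases "hd w") (auto simp: reduced_Cons)

lemma foldr_letter_mult_reduced: "reduced w \<Longrightarrow> reduced (foldr letter_mult u w)"
  by (induction u) (auto intro: letter_mult_reduced)

lemma foldr_letter_mult_Nil: "reduced u \<Longrightarrow> foldr letter_mult u [] = u"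
proof (induction u)
  case (Cons x u)
  then show ?case by (cases u; cases x; cases "hd u") (auto simp: reduced_Cons)
qed simp

lemma letter_mult_junction:
  assumes "reduced w"
  shows "letter_mult x (letter_mult y w) = foldr letter_mult (junction x y) w"
  using assms
  by (cases w; cases x; cases y; cases "hd w"; cases "tl w"; cases "hd (tl w)")
     (auto simp: reduced_Cons)

lemma foldr_letter_mult_assoc:
  assumes "reduced w"
  shows "foldr letter_mult (foldr letter_mult u v) w = foldr letter_mult u (foldr letter_mult v w)"
proof (induction u)
  case (Cons x u)
  have "foldr letter_mult (letter_mult x z) w = letter_mult x (foldr letter_mult z w)" for z
    by (cases z) (simp_all add: letter_mult_junction foldr_letter_mult_reduced assms)
  with Cons show ?case by simp
qed simp

lemma letter_inverse: "\<exists>y. \<forall>w. reduced w \<longrightarrow> letter_mult y (letter_mult x w) = w"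
proof (cases x)
  case La
  then show ?thesis by (intro exI[of _ La]) (simp add: letter_mult_junction)
next
  case Lb
  then show ?thesis by (intro exI[of _ Lbbar]) (simp add: letter_mult_junction)
next
  case Lbbar
  then show ?thesis by (intro exI[of _ Lb]) (simp add: letter_mult_junction)
qed

theorem group_Gamma: "group Gamma"
proof (rule groupI)
  fix x assume "x \<in> carrier Gamma"
  have "\<exists>y. reduced y \<and> foldr letter_mult y x = []" if "reduced x" for x
    using that
  proof (induction x)
    case Nil
    then show ?case by (intro exI[of _ "[]"]) simp
  next
    case (Cons c x)
    then obtain y where y: "reduced y" "foldr letter_mult y x = []"
      by (auto simp: reduced_Cons)
    obtain d where d: "\<And>w. reduced w \<Longrightarrow> letter_mult d (letter_mult c w) = w"
      using letter_inverse[of c] by blast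
    have "reduced x" using Cons.prems by (simp add: reduced_Cons)
    have "letter_mult c x = c # x"
      using Cons.prems by (cases x; cases c; cases "hd x") (auto simp: reduced_Cons)
    then have "foldr letter_mult [d] (c # x) = x"
      using d[OF \<open>reduced x\<close>] by simp
    moreover have "foldr letter_mult (foldr letter_mult y [d]) (c # x)
        = foldr letter_mult y (foldr letter_mult [d] (c # x))"
      by (rule foldr_letter_mult_assoc[OF Cons.prems])
    ultimately have "foldr letter_mult (foldr letter_mult y [d]) (c # x) = []"
      using y by simp
    moreover have "reduced (foldr letter_mult y [d])"
      by (intro foldr_letter_mult_reduced) (simp add: reduced_def)
    ultimately show ?case by blast
  qed
  then show "\<exists>y\<in>carrier Gamma. y \<otimes>\<^bsub>Gamma\<^esub> x = \<one>\<^bsub>Gamma\<^esub>"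
    using \<open>x \<in> carrier Gamma\<close> by (auto simp: Gamma_def)
qed (auto simp: Gamma_def reduced_Nil foldr_letter_mult_reduced foldr_letter_mult_assoc)

lemma pmf_convex_comb:
  assumes "0 \<le> t" "t \<le> 1"
  shows "pmf (convex_comb_pmf t \<mu>\<^sub>1 \<mu>\<^sub>2) g = t * pmf \<mu>\<^sub>1 g + (1 - t) * pmf \<mu>\<^sub>2 g"
  using assms by (simp add: convex_comb_pmf_def pmf_bind)

lemma all_nat_split: "(\<forall>i. P i) \<longleftrightarrow> P 0 \<and> (\<forall>i. P (Suc i))"
  by (metis nat.exhaust)

lemma letter_act_boundary: "\<gamma> \<in> boundary \<Longrightarrow> letter_act x \<gamma> \<in> boundary"
proof -
  assume *: "\<gamma> \<in> boundary"
  have 1: "y ## \<delta> \<in> boundary \<longleftrightarrow> alternate y (shd \<delta>) \<and> \<delta> \<in> boundary" for y \<delta>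
    unfolding boundary_def mem_Collect_eq all_nat_split[of "\<lambda>i. alternate ((y ## \<delta>) !! i) ((y ## \<delta>) !! Suc i)"]
    by simp
  obtain y z \<delta> where \<gamma>: "\<gamma> = y ## z ## \<delta>" by (metis stream.collapse)
  show ?thesis
    using * unfolding \<gamma> by (cases x; cases y; cases z) (auto simp: letter_act_def 1)
qed

lemma coin_word_Stream: "coin_word (c ## \<omega>) = La ## (if c then Lb else Lbbar) ## coin_word \<omega>"
  by (simp add: coin_word_def)

lemma coin_word_snth:
  "coin_word \<omega> !! n = (if even n then La else if \<omega> !! (n div 2) then Lb else Lbbar)"
proof (induction n arbitrary: \<omega> rule: induct_nat_012)
  case 0
  then show ?case by (cases \<omega>) (simp add: coin_word_Stream)
next
  case 1
  then show ?case by (cases \<omega>) (simp add: coin_word_Stream)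
next
  case (ge2 n)
  then show ?case by (cases \<omega>) (simp add: coin_word_Stream)
qed

lemma space_boundary_space: "space boundary_space = boundary"
  by (simp add: boundary_space_def space_restrict_space space_stream_space)

lemma measurable_coin_word:
  "coin_word \<in> measurable (stream_space (measure_pmf (bernoulli_pmf \<alpha>))) boundary_space"
  unfolding boundary_space_def
proof (rule measurable_restrict_space2)
  show "coin_word \<in> measurable (stream_space (measure_pmf (bernoulli_pmf \<alpha>)))
      (stream_space (count_space UNIV))"
  proof (rule measurable_stream_space2)
    fix n
    have "(\<lambda>\<omega>. \<omega> !! (n div 2)) \<in> measurable (stream_space (measure_pmf (bernoulli_pmf \<alpha>)))
        (count_space UNIV)"
      by (metis measurable_cong_sets measurable_snth sets_measure_pmf_count_space)
    then show "(\<lambda>\<omega>. coin_word \<omega> !! n) \<in> measurable (stream_space (measure_pmf (bernoulli_pmf \<alpha>)))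
        (count_space UNIV)"
      unfolding coin_word_snth by measurable
  qed
qed (auto simp: boundary_def coin_word_snth simp del: snth.simps)

lemma measurable_letter_act: "letter_act x \<in> measurable boundary_space boundary_space"
proof -
  have "letter_act x \<in> measurable (stream_space (count_space UNIV)) (stream_space (count_space UNIV))"
    unfolding letter_act_def
  proof (rule measurable_compose_countable[where g=shd])
    fix y
    show "(\<lambda>\<gamma>. junction x y @- stl \<gamma>) \<in>
        measurable (stream_space (count_space UNIV)) (stream_space (count_space UNIV))"
      by (cases x; cases y) simp_all
  qed (rule measurable_shd)
  then show ?thesis
    unfolding boundary_space_def
    by (intro measurable_restrict_space2 measurable_restrict_space1)
       (auto simp: space_restrict_space letter_act_boundary)
qed

lemma emeasure_kappa_mix:
  assumes "A \<in> sets boundary_space"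
  shows "emeasure (kappa_mix \<alpha> p) A = ennreal p * emeasure (kappa \<alpha>) A
    + ennreal (1 - p) * emeasure (distr (kappa \<alpha>) boundary_space (act [La])) A"
proof (rule emeasure_measure_of[OF kappa_mix_def])
  let ?m = "\<lambda>A. ennreal p * emeasure (kappa \<alpha>) A
    + ennreal (1 - p) * emeasure (distr (kappa \<alpha>) boundary_space (act [La])) A"
  show "countably_additive (sets (kappa_mix \<alpha> p)) ?m"
    unfolding countably_additive_def
  proof (intro allI impI)
    fix B :: "nat \<Rightarrow> letter stream set"
    assume *: "range B \<subseteq> sets (kappa_mix \<alpha> p)" "disjoint_family B"
    then have "(\<Sum>i. emeasure M (B i)) = emeasure M (\<Union>i. B i)"
      if "sets M = sets boundary_space" for M
      using that by (intro suminf_emeasure) (auto simp: kappa_mix_def)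
    then show "(\<Sum>i. ?m (B i)) = ?m (\<Union>i. B i)"
      by (simp add: suminf_add[symmetric] kappa_def)
  qed
qed (auto simp: assms kappa_mix_def positive_def dest: sets.sets_into_space)

lemma prob_space_kappa_mix:
  assumes "0 \<le> p" "p \<le> 1"
  shows "prob_space (kappa_mix \<alpha> p)"
proof
  have k: "prob_space (kappa \<alpha>)"
    unfolding kappa_def
    by (intro prob_space.prob_space_distr prob_space.prob_space_stream_space
          prob_space_measure_pmf measurable_coin_word)
  have "act [La] \<in> measurable (kappa \<alpha>) boundary_space"
    using measurable_letter_act[of La] unfolding act_def kappa_def by simp
  then have k': "prob_space (distr (kappa \<alpha>) boundary_space (act [La]))"
    by (rule prob_space.prob_space_distr[OF k])
  have [simp]: "space (kappa_mix \<alpha> p) = space boundary_space"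
    by (simp add: kappa_mix_def)
  have "emeasure (kappa \<alpha>) (space boundary_space) = 1"
    "emeasure (distr (kappa \<alpha>) boundary_space (act [La])) (space boundary_space) = 1"
    using prob_space.emeasure_space_1[OF k] prob_space.emeasure_space_1[OF k']
    by (simp_all add: kappa_def)
  then show "emeasure (kappa_mix \<alpha> p) (space (kappa_mix \<alpha> p)) = 1"
    using assms by (simp add: emeasure_kappa_mix flip: ennreal_plus)
qed

end

theory Submission
  imports Defs
begin

text \<open>
  A step from \<open>S\<close> moves the walk by at most one edge in the tree of cosets of \<open>\<int>\<^sub>3\<close>, and it
  always enters a coset through the same point; hence the harmonic measure of every non-degenerate measure on
  \<open>S\<close> is of the form \<open>\<kappa>\<^sup>\<alpha>\<^sup>,\<^sup>p\<close>, and it lies in the Minkowski class iff \<open>\<alpha> = 1/2\<close>. The latter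
  condition is a quadratic equation in \<open>\<mu>\<close>; we take two of its solutions for which the open
  segment between them contains no other solution.

  That a stationary \<open>\<kappa>\<^sup>\<alpha>\<^sup>,\<^sup>p\<close> is the harmonic measure is seen as follows. If \<open>N g\<close> is the number of
  letters \<open>a\<close> in \<open>g\<close>, then \<open>(3/4)\<^sup>N\<close> contracts in mean under each step, so \<open>N g\<^sub>n \<rightarrow> \<infinity>\<close> almost surely
  and the prefixes of \<open>g\<^sub>n\<close> stabilise. For a boundary point \<open>\<gamma>\<close> the word \<open>g\<^sub>n\<gamma>\<close> has the same prefix
  as \<open>g\<^sub>n\<close> unless \<open>\<gamma>\<close> begins with the inverse of a long suffix of \<open>g\<^sub>n\<close>, which has small measure.
  Hence the translates of the stationary measure by \<open>g\<^sub>n\<close> converge to the point mass at the limit,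
  while their average is the stationary measure itself.
\<close>

section \<open>Reduced words and the boundary action\<close>

lemma mult_Gamma: "u \<otimes>\<^bsub>Gamma\<^esub> v = foldr letter_mult u v"
  by (simp add: Gamma_def)

lemma carrier_Gamma: "carrier Gamma = {w. reduced w}"
  by (simp add: Gamma_def)

lemma step_set_reduced: "h \<in> step_set \<Longrightarrow> reduced h"
  by (auto simp: step_set_def reduced_Cons reduced_Nil)

lemma reduced_append:
  "reduced (u @ v) \<longleftrightarrow> reduced u \<and> reduced v \<and> (u = [] \<or> v = [] \<or> alternate (last u) (hd v))"
  by (induction u) (auto simp: reduced_Cons reduced_Nil hd_append)

lemma foldr_letter_mult_append: "reduced (u @ w) \<Longrightarrow> foldr letter_mult u w = u @ w"
proof (induction u)
  case (Cons x u)
  then show ?case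
    by (cases "u @ w"; cases x; cases "hd (u @ w)") (auto simp: reduced_Cons)
qed simp

lemma Stream_boundary: "y ## \<delta> \<in> boundary \<longleftrightarrow> alternate y (shd \<delta>) \<and> \<delta> \<in> boundary"
  unfolding boundary_def mem_Collect_eq
    all_nat_split[of "\<lambda>i. alternate ((y ## \<delta>) !! i) ((y ## \<delta>) !! Suc i)"]
  by simp

lemma act_Nil [simp]: "act [] \<gamma> = \<gamma>"
  and act_Cons [simp]: "act (x # w) \<gamma> = letter_act x (act w \<gamma>)"
  and act_append: "act (u @ v) \<gamma> = act u (act v \<gamma>)"
  by (simp_all add: act_def)

lemma act_boundary: "\<gamma> \<in> boundary \<Longrightarrow> act w \<gamma> \<in> boundary"
  by (induction w) (auto intro: letter_act_boundary)

lemma letter_act_junction: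
  assumes "\<gamma> \<in> boundary"
  shows "letter_act x (letter_act y \<gamma>) = act (junction x y) \<gamma>"
proof -
  obtain u v \<delta> where \<gamma>: "\<gamma> = u ## v ## \<delta>" by (metis stream.collapse)
  show ?thesis
    using assms unfolding \<gamma>
    by (cases x; cases y; cases u; cases v) (auto simp: letter_act_def Stream_boundary)
qed

lemma act_mult:
  assumes "\<gamma> \<in> boundary"
  shows "act (foldr letter_mult u v) \<gamma> = act u (act v \<gamma>)"
proof -
  have "act (letter_mult x w) \<gamma> = letter_act x (act w \<gamma>)" for x w
    by (cases w) (auto simp: act_append letter_act_junction act_boundary assms)
  then show ?thesis by (induction u) auto
qed

lemma act_eq_shift:
  assumes "reduced u" "u = [] \<or> alternate (last u) (shd \<gamma>)"
  shows "act u \<gamma> = u @- \<gamma>"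
  using assms
proof (induction u)
  case (Cons x u)
  then have eq: "act u \<gamma> = u @- \<gamma>" by (auto simp: reduced_Cons split: if_splits)
  have "alternate x (shd (u @- \<gamma>))"
    using Cons.prems by (cases u) (auto simp: reduced_Cons)
  moreover obtain y \<delta> where "u @- \<gamma> = y ## \<delta>" by (metis stream.collapse)
  ultimately have "letter_act x (u @- \<gamma>) = x ## u @- \<gamma>"
    by (cases x; cases y) (auto simp: letter_act_def)
  then show ?case using eq by simp
qed simp

section \<open>Cancellation in the boundary action\<close>

fun letter_inv :: "letter \<Rightarrow> letter" where
  "letter_inv La = La"
| "letter_inv Lb = Lbbar"
| "letter_inv Lbbar = Lb"

text \<open>A letter that is kept, or merged with a letter of its own kind, leaves a word starting
  with that kind. A start of the other kind is therefore possible only after full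
  cancellation.\<close>

lemma letter_act_cancel:
  assumes "\<gamma> \<in> boundary" "alternate y (shd (letter_act y \<gamma>))"
  shows "\<gamma> = letter_inv y ## letter_act y \<gamma>"
proof -
  obtain u v \<delta> where \<gamma>: "\<gamma> = u ## v ## \<delta>" by (metis stream.collapse)
  show ?thesis
    using assms unfolding \<gamma>
    by (cases y; cases u; cases v) (auto simp: letter_act_def Stream_boundary)
qed

text \<open>The letters of \<open>w\<close> act from the right. If the last one did not cancel, what
  remains of \<open>v @ w\<close> would be prepended without reduction and the first letter of
  \<open>v\<close> would survive. So each letter of \<open>w\<close> in turn must meet its inverse
  in \<gamma>.\<close>

lemma stake_eq_inverse_of_cancelling:
  assumes "reduced (v @ w)" "v \<noteq> []" "\<gamma> \<in> boundary" "shd (act (v @ w) \<gamma>) \<noteq> hd v"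
  shows "stake (length w) \<gamma> = map letter_inv (rev w)"
  using assms
proof (induction w arbitrary: \<gamma> rule: rev_induct)
  case (snoc y w)
  let ?\<delta> = "letter_act y \<gamma>"
  have red: "reduced (v @ w)" "alternate (last (v @ w)) y"
    using snoc.prems(1,2) reduced_append[of "v @ w" "[y]"] by auto
  have \<delta>: "?\<delta> \<in> boundary" "shd (act (v @ w) ?\<delta>) \<noteq> hd v"
    using snoc.prems by (auto simp: letter_act_boundary act_append)
  have "\<not> alternate (last (v @ w)) (shd ?\<delta>)"
  proof
    assume "alternate (last (v @ w)) (shd ?\<delta>)"
    then have "act (v @ w) ?\<delta> = (v @ w) @- ?\<delta>"
      using red by (intro act_eq_shift) auto
    then show False using \<delta>(2) snoc.prems(2) by (cases v) auto
  qed
  with red have "alternate y (shd ?\<delta>)" by blast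
  then have "\<gamma> = letter_inv y ## ?\<delta>"
    by (rule letter_act_cancel[OF snoc.prems(3)])
  then have "stake (length (w @ [y])) \<gamma> = letter_inv y # stake (length w) ?\<delta>"
    by (metis length_append_singleton stake.simps(2) stream.sel)
  with snoc.IH[OF red(1) snoc.prems(2) \<delta>] show ?case by simp
qed simp

lemma take_mult_step:
  assumes g: "reduced g" and h: "h \<in> step_set" and k: "k + 2 \<le> length g"
  shows "take k (foldr letter_mult g h) = take k g \<and> k \<le> length (foldr letter_mult g h)"
proof -
  define u x y where "u = take (length g - 2) g" "x = g ! (length g - 2)" "y = g ! (length g - 1)"
  have "drop (length g - 2) g = [x, y]"
    using k unfolding u_x_y_def
    by (intro nth_equalityI) (auto simp: nth_Cons less_Suc_eq_0_disj Suc_diff_Suc split: nat.splits)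
  then have g_eq: "g = u @ [x, y]"
    unfolding u_x_y_def by (metis append_take_drop_id)
  define w where "w = foldr letter_mult [x, y] h"
  have "alternate x y" using g unfolding g_eq by (auto simp: reduced_append reduced_Cons)
  \<comment> \<open>If \<open>y\<close> is a power of b, then \<open>x\<close> is a and can only
    stay or vanish. If \<open>y\<close> is a, only the step a cancels it, and no letter of the step
    is left to act on \<open>x\<close>. Hence nothing to the left of \<open>x\<close> is
    reduced.\<close>
  then have "w = [] \<or> hd w = x"
    using h unfolding w_def step_set_def by (cases x; cases y) auto
  moreover have "reduced w"
    unfolding w_def by (rule foldr_letter_mult_reduced[OF step_set_reduced[OF h]])
  ultimately have "foldr letter_mult u w = u @ w"
    using g unfolding g_eq
    by (intro foldr_letter_mult_append) (auto simp: reduced_append)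
  then have "foldr letter_mult g h = u @ w" by (simp add: g_eq w_def)
  then show ?thesis using k unfolding g_eq by simp
qed

section \<open>The measures \<open>\<kappa>\<^sup>\<alpha>\<^sup>,\<^sup>p\<close> and stationarity\<close>

abbreviation coins :: "real \<Rightarrow> bool stream measure" where
  "coins \<alpha> \<equiv> stream_space (measure_pmf (bernoulli_pmf \<alpha>))"

lemma prob_space_stream_pmf: "prob_space (stream_space (measure_pmf M))"
  by (rule prob_space.prob_space_stream_space[OF prob_space_measure_pmf])

lemma space_stream_pmf: "space (stream_space (measure_pmf M)) = UNIV"
  by (simp add: space_stream_space)

lemma measurable_act: "act g \<in> measurable boundary_space boundary_space"
proof (induction g)
  case Nil
  then show ?case by (simp add: act_def[abs_def])
next
  case (Cons x g)
  then show ?case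
    using measurable_compose[OF Cons measurable_letter_act[of x]] by (simp add: act_def[abs_def])
qed

lemma act_vimage_sets:
  assumes "A \<in> sets boundary_space"
  shows "{\<gamma> \<in> boundary. act g \<gamma> \<in> A} \<in> sets boundary_space"
  using measurable_sets[OF measurable_act assms, of g]
  by (simp add: space_boundary_space vimage_def Int_def conj_commute)

lemma coin_word_boundary: "coin_word \<omega> \<in> boundary"
  by (auto simp: boundary_def coin_word_snth simp del: snth.simps)

lemma act_coin_word:
  "act [La] (coin_word \<omega>) = stl (coin_word \<omega>)"
  "act [La] (stl (coin_word \<omega>)) = coin_word \<omega>"
proof -
  show "act [La] (coin_word \<omega>) = stl (coin_word \<omega>)"
    by (cases \<omega>) (simp add: coin_word_Stream letter_act_def)
  show "act [La] (stl (coin_word \<omega>)) = coin_word \<omega>"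
    by (cases \<omega>) (simp add: coin_word_Stream letter_act_def)
qed

lemma stl_coin_word_boundary: "stl (coin_word \<omega>) \<in> boundary"
  by (metis act_boundary act_coin_word(1) coin_word_boundary)

lemma measurable_stl_coin_word:
  "(\<lambda>\<omega>. stl (coin_word \<omega>)) \<in> measurable (coins \<alpha>) boundary_space"
  using measurable_compose[OF measurable_coin_word measurable_act[of "[La]"], of \<alpha>]
  by (simp only: act_coin_word)

lemma coin_word_vimage_sets:
  assumes "A \<in> sets boundary_space"
  shows "{\<omega>. coin_word \<omega> \<in> A} \<in> sets (coins \<alpha>)" "{\<omega>. stl (coin_word \<omega>) \<in> A} \<in> sets (coins \<alpha>)"
  using measurable_sets[OF measurable_coin_word assms, of \<alpha>]
    measurable_sets[OF measurable_stl_coin_word assms, of \<alpha>]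
  by (simp_all add: space_stream_pmf vimage_def)

lemma emeasure_kappa_mix_coins:
  assumes "A \<in> sets boundary_space"
  shows "emeasure (kappa_mix \<alpha> p) A = ennreal p * emeasure (coins \<alpha>) {\<omega>. coin_word \<omega> \<in> A}
    + ennreal (1 - p) * emeasure (coins \<alpha>) {\<omega>. stl (coin_word \<omega>) \<in> A}"
proof -
  have "distr (kappa \<alpha>) boundary_space (act [La])
      = distr (coins \<alpha>) boundary_space (\<lambda>\<omega>. stl (coin_word \<omega>))"
    unfolding kappa_def
    by (subst distr_distr) (auto simp: measurable_act measurable_coin_word comp_def act_coin_word
        simp del: act_Cons)
  then show ?thesis
    using assms
    by (simp add: emeasure_kappa_mix kappa_def emeasure_distr measurable_coin_word
        measurable_stl_coin_word space_stream_pmf vimage_def)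
qed

lemma sets_kappa_mix [simp]: "sets (kappa_mix \<alpha> p) = sets boundary_space"
  by (simp add: kappa_mix_def)

lemma space_kappa_mix: "space (kappa_mix \<alpha> p) = boundary"
  by (metis sets_eq_imp_space_eq sets_kappa_mix space_boundary_space)

lemma measure_kappa_mix:
  assumes "A \<in> sets boundary_space" "0 \<le> p" "p \<le> 1"
  shows "measure (kappa_mix \<alpha> p) A = p * measure (coins \<alpha>) {\<omega>. coin_word \<omega> \<in> A}
    + (1 - p) * measure (coins \<alpha>) {\<omega>. stl (coin_word \<omega>) \<in> A}"
proof -
  interpret C: prob_space "coins \<alpha>" by (rule prob_space_stream_pmf)
  interpret K: prob_space "kappa_mix \<alpha> p" by (rule prob_space_kappa_mix[OF assms(2,3)])
  show ?thesis
    using emeasure_kappa_mix_coins[OF assms(1), of \<alpha> p] assms(2,3)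
    by (simp add: K.emeasure_eq_measure C.emeasure_eq_measure flip: ennreal_mult ennreal_plus)
qed

section \<open>Masses of cylinder sets\<close>

lemma measure_coins_Stream:
  assumes X: "X \<in> sets (coins \<alpha>)" and \<alpha>: "0 \<le> \<alpha>" "\<alpha> \<le> 1"
  shows "measure (coins \<alpha>) X = \<alpha> * measure (coins \<alpha>) {\<omega>. True ## \<omega> \<in> X}
    + (1 - \<alpha>) * measure (coins \<alpha>) {\<omega>. False ## \<omega> \<in> X}"
proof -
  interpret C: prob_space "coins \<alpha>" by (rule prob_space_stream_pmf)
  have "emeasure (coins \<alpha>) X = (\<integral>\<^sup>+c. emeasure (coins \<alpha>) {\<omega>. c ## \<omega> \<in> X} \<partial>bernoulli_pmf \<alpha>)"
    using prob_space.emeasure_stream_space[OF prob_space_measure_pmf X]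
    by (simp add: space_stream_pmf)
  then show ?thesis
    using \<alpha> by (simp add: C.emeasure_eq_measure flip: ennreal_mult ennreal_plus)
qed

lemma measure_coins_prefix_le:
  assumes \<alpha>: "0 \<le> \<alpha>" "\<alpha> \<le> 1"
  shows "measure (coins \<alpha>) {\<omega>. \<forall>i<m. \<omega> !! i = d i} \<le> max \<alpha> (1 - \<alpha>) ^ m"
proof (induction m arbitrary: d)
  case 0
  interpret prob_space "coins \<alpha>" by (rule prob_space_stream_pmf)
  show ?case by simp
next
  case (Suc m)
  let ?X = "{\<omega>. \<forall>i<Suc m. \<omega> !! i = d i}" and ?Y = "{\<omega>. \<forall>i<m. \<omega> !! i = d (Suc i)}"
  have [measurable]: "(\<lambda>\<omega>. \<omega> !! i = b) \<in> measurable (coins \<alpha>) (count_space UNIV)" for i b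
    by (rule measurable_compose[OF measurable_snth]) simp
  have "{\<omega> \<in> space (coins \<alpha>). \<forall>i<Suc m. \<omega> !! i = d i} \<in> sets (coins \<alpha>)"
    by measurable
  then have X: "?X \<in> sets (coins \<alpha>)" by (simp add: space_stream_pmf)
  have "{\<omega>. c ## \<omega> \<in> ?X} = (if c = d 0 then ?Y else {})" for c
    by (auto simp: less_Suc_eq_0_disj)
  then have "measure (coins \<alpha>) ?X = (if d 0 then \<alpha> else 1 - \<alpha>) * measure (coins \<alpha>) ?Y"
    by (subst measure_coins_Stream[OF X \<alpha>]) auto
  also have "\<dots> \<le> max \<alpha> (1 - \<alpha>) * max \<alpha> (1 - \<alpha>) ^ m"
    using \<alpha> by (intro mult_mono Suc.IH) auto
  finally show ?case by simp
qed

lemma stake_vimage_sets: "{\<gamma> \<in> boundary. stake n \<gamma> = w} \<in> sets boundary_space"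
proof -
  have "{\<gamma> \<in> space (stream_space (count_space UNIV)). stake n \<gamma> = w}
      \<in> sets (stream_space (count_space UNIV))"
    by measurable
  then have "boundary \<inter> {\<gamma>. stake n \<gamma> = w} \<in> sets boundary_space"
    unfolding boundary_space_def sets_restrict_space by (auto simp: space_stream_space)
  then show ?thesis by (simp add: Int_def)
qed

text \<open>Among any 2m consecutive letters exactly m are powers of b, whichever kind comes first.
  So the prefix fixes m coins for both components of the mixture, at odd positions for one and at
  even positions for the other.\<close>

lemma measure_kappa_mix_stake_le:
  assumes \<alpha>: "0 \<le> \<alpha>" "\<alpha> \<le> 1" and p: "0 \<le> p" "p \<le> 1"
  shows "measure (kappa_mix \<alpha> p) {\<gamma> \<in> boundary. stake (2 * m) \<gamma> = w} \<le> max \<alpha> (1 - \<alpha>) ^ m"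
proof -
  interpret C: prob_space "coins \<alpha>" by (rule prob_space_stream_pmf)
  let ?A = "{\<gamma> \<in> boundary. stake (2 * m) \<gamma> = w}"
  have [measurable]: "(\<lambda>\<omega>. \<omega> !! i = b) \<in> measurable (coins \<alpha>) (count_space UNIV)" for i b
    by (rule measurable_compose[OF measurable_snth]) simp
  have "{\<omega> \<in> space (coins \<alpha>). \<forall>i<m. \<omega> !! i = d i} \<in> sets (coins \<alpha>)" for d
    by measurable
  then have D: "{\<omega>. \<forall>i<m. \<omega> !! i = d i} \<in> sets (coins \<alpha>)" for d
    by (simp add: space_stream_pmf)
  have nth: "\<gamma> !! i = w ! i" if "\<gamma> \<in> ?A" "i < 2 * m" for \<gamma> i
    using that by (metis (mono_tags, lifting) mem_Collect_eq stake_nth)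
  have "\<omega> !! i = (w ! (2 * i + 1) = Lb)" if "coin_word \<omega> \<in> ?A" "i < m" for \<omega> i
    using nth[OF that(1), of "2 * i + 1"] that(2)
    by (auto simp: coin_word_snth simp del: snth.simps split: if_splits)
  then have "{\<omega>. coin_word \<omega> \<in> ?A} \<subseteq> {\<omega>. \<forall>i<m. \<omega> !! i = (w ! (2 * i + 1) = Lb)}"
    by blast
  then have 1: "measure (coins \<alpha>) {\<omega>. coin_word \<omega> \<in> ?A} \<le> max \<alpha> (1 - \<alpha>) ^ m"
    by (rule order.trans[OF C.finite_measure_mono[OF _ D] measure_coins_prefix_le[OF \<alpha>]])
  have "\<omega> !! i = (w ! (2 * i) = Lb)" if "stl (coin_word \<omega>) \<in> ?A" "i < m" for \<omega> i
  proof -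
    have "coin_word \<omega> !! (2 * i + 1) = w ! (2 * i)"
      using nth[OF that(1), of "2 * i"] that(2) by simp
    then show ?thesis
      by (auto simp: coin_word_snth simp del: snth.simps split: if_splits)
  qed
  then have "{\<omega>. stl (coin_word \<omega>) \<in> ?A} \<subseteq> {\<omega>. \<forall>i<m. \<omega> !! i = (w ! (2 * i) = Lb)}"
    by blast
  then have 2: "measure (coins \<alpha>) {\<omega>. stl (coin_word \<omega>) \<in> ?A} \<le> max \<alpha> (1 - \<alpha>) ^ m"
    by (rule order.trans[OF C.finite_measure_mono[OF _ D] measure_coins_prefix_le[OF \<alpha>]])
  show ?thesis
    unfolding measure_kappa_mix[OF stake_vimage_sets p]
    using p by (intro convex_bound_le 1 2) auto
qed

section \<open>Stationary measures\<close>

definition stationary :: "letter list pmf \<Rightarrow> letter stream measure \<Rightarrow> bool" where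
  "stationary \<mu> \<nu> \<longleftrightarrow> (\<forall>A \<in> sets boundary_space.
     emeasure \<nu> A = (\<integral>\<^sup>+g. emeasure \<nu> {\<gamma> \<in> boundary. act g \<gamma> \<in> A} \<partial>measure_pmf \<mu>))"

lemma nn_integral_step_set:
  assumes "set_pmf \<mu> \<subseteq> step_set" "\<And>g. 0 \<le> f g"
  shows "(\<integral>\<^sup>+g. ennreal (f g) \<partial>measure_pmf \<mu>) = ennreal (pmf \<mu> [La] * f [La] + pmf \<mu> [Lb] * f [Lb]
    + pmf \<mu> [Lbbar] * f [Lbbar] + pmf \<mu> [Lb, La] * f [Lb, La] + pmf \<mu> [Lbbar, La] * f [Lbbar, La])"
proof -
  have "(\<integral>\<^sup>+g. ennreal (f g) \<partial>measure_pmf \<mu>) = (\<Sum>g\<in>step_set. ennreal (f g) * pmf \<mu> g)"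
    using assms by (intro nn_integral_measure_pmf_support) (auto simp: step_set_def)
  also have "\<dots> = ennreal (\<Sum>g\<in>step_set. pmf \<mu> g * f g)"
    using assms by (simp add: ennreal_mult' mult.commute flip: sum_ennreal)
  finally show ?thesis by (simp add: step_set_def add.assoc)
qed

text \<open>With \<open>\<kappa> = \<kappa>\<^sup>\<alpha>\<close>, both sides of the stationarity equation are combinations of \<open>\<kappa>\<close>, \<open>b\<kappa>\<close> and
  \<open>b\<^sup>-\<^sup>1\<kappa>\<close>. The two conditions compare the coefficients of \<open>\<kappa>\<close> and \<open>b\<kappa>\<close>; those of \<open>b\<^sup>-\<^sup>1\<kappa>\<close> then agree
  because both sides have total mass 1.\<close>

theorem stationary_kappa_mix:
  assumes \<mu>: "set_pmf \<mu> \<subseteq> step_set" and \<alpha>: "0 \<le> \<alpha>" "\<alpha> \<le> 1" and p: "0 \<le> p" "p \<le> 1"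
    and eq_a: "p = pmf \<mu> [La] * (1 - p) + (pmf \<mu> [Lb] * (1 - \<alpha>) + pmf \<mu> [Lbbar] * \<alpha>) * (1 - p)
      + (pmf \<mu> [Lb, La] * (1 - \<alpha>) + pmf \<mu> [Lbbar, La] * \<alpha>) * p"
    and eq_b: "(1 - p) * \<alpha> = pmf \<mu> [La] * p * \<alpha> + pmf \<mu> [Lb] * p + pmf \<mu> [Lbbar] * (1 - p) * (1 - \<alpha>)
      + pmf \<mu> [Lb, La] * (1 - p) + pmf \<mu> [Lbbar, La] * p * (1 - \<alpha>)"
  shows "stationary \<mu> (kappa_mix \<alpha> p)"
  unfolding stationary_def
proof
  have "(\<integral>\<^sup>+g. ennreal 1 \<partial>measure_pmf \<mu>) = 1" by simp
  then have "pmf \<mu> [La] + pmf \<mu> [Lb] + pmf \<mu> [Lbbar] + pmf \<mu> [Lb, La] + pmf \<mu> [Lbbar, La] = 1"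
    by (subst (asm) nn_integral_step_set[OF \<mu>]) (simp_all del: ennreal_plus)
  then have eq_bbar: "(1 - p) * (1 - \<alpha>) = pmf \<mu> [La] * p * (1 - \<alpha>) + pmf \<mu> [Lb] * (1 - p) * \<alpha>
      + pmf \<mu> [Lbbar] * p + pmf \<mu> [Lb, La] * p * \<alpha> + pmf \<mu> [Lbbar, La] * (1 - p)"
    using eq_a eq_b by algebra
  fix A assume A: "A \<in> sets boundary_space"
  interpret K: prob_space "kappa_mix \<alpha> p" by (rule prob_space_kappa_mix[OF p])
  let ?P = "\<lambda>f. measure (coins \<alpha>) {\<omega>. f \<omega> \<in> A}"
  define k x y where "k = ?P coin_word" "x = ?P (\<lambda>\<omega>. Lb ## coin_word \<omega>)"
    "y = ?P (\<lambda>\<omega>. Lbbar ## coin_word \<omega>)"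
  define m where "m g = measure (kappa_mix \<alpha> p) {\<gamma> \<in> boundary. act g \<gamma> \<in> A}" for g
  have m: "m g = p * ?P (\<lambda>\<omega>. act g (coin_word \<omega>)) + (1 - p) * ?P (\<lambda>\<omega>. act g (stl (coin_word \<omega>)))" for g
    unfolding m_def
    by (subst measure_kappa_mix[OF act_vimage_sets[OF A] p])
      (simp add: coin_word_boundary stl_coin_word_boundary)
  \<comment> \<open>Conditioning on the first coin expresses the image of
    \<open>kappa \<alpha>\<close> under a as the mixture, with weights \<alpha> and 1 - \<alpha>, of
    its images under b and the inverse of b.\<close>
  have split: "?P (\<lambda>\<omega>. act g (stl (coin_word \<omega>)))
      = \<alpha> * ?P (\<lambda>\<omega>. act g (Lb ## coin_word \<omega>)) + (1 - \<alpha>) * ?P (\<lambda>\<omega>. act g (Lbbar ## coin_word \<omega>))" for g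
    using coin_word_vimage_sets(2)[OF act_vimage_sets[OF A], of g \<alpha>]
    by (subst measure_coins_Stream[OF _ \<alpha>])
      (simp_all add: coin_word_Stream stl_coin_word_boundary)
  have shd: "shd (coin_word \<omega>) = La" for \<omega>
    by (cases \<omega>) (simp add: coin_word_Stream)
  have la: "letter_act Lb (coin_word \<omega>) = Lb ## coin_word \<omega>"
    "letter_act Lbbar (coin_word \<omega>) = Lbbar ## coin_word \<omega>"
    "letter_act Lb (Lb ## coin_word \<omega>) = Lbbar ## coin_word \<omega>"
    "letter_act Lb (Lbbar ## coin_word \<omega>) = coin_word \<omega>"
    "letter_act Lbbar (Lb ## coin_word \<omega>) = coin_word \<omega>"
    "letter_act Lbbar (Lbbar ## coin_word \<omega>) = Lb ## coin_word \<omega>"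
    "letter_act La (coin_word \<omega>) = stl (coin_word \<omega>)"
    "letter_act La (stl (coin_word \<omega>)) = coin_word \<omega>" for \<omega>
    using act_coin_word[of \<omega>] shd[of \<omega>]
    by (simp_all add: letter_act_def) (metis stream.collapse)+
  have \<theta>: "?P (\<lambda>\<omega>. stl (coin_word \<omega>)) = \<alpha> * x + (1 - \<alpha>) * y"
    "?P (\<lambda>\<omega>. letter_act Lb (stl (coin_word \<omega>))) = \<alpha> * y + (1 - \<alpha>) * k"
    "?P (\<lambda>\<omega>. letter_act Lbbar (stl (coin_word \<omega>))) = \<alpha> * k + (1 - \<alpha>) * x"
    using split[of "[]"] split[of "[Lb]"] split[of "[Lbbar]"] by (simp_all add: la k_x_y_def)
  have ms: "m [La] = p * (\<alpha> * x + (1 - \<alpha>) * y) + (1 - p) * k"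
    "m [Lb] = p * x + (1 - p) * (\<alpha> * y + (1 - \<alpha>) * k)"
    "m [Lbbar] = p * y + (1 - p) * (\<alpha> * k + (1 - \<alpha>) * x)"
    "m [Lb, La] = p * (\<alpha> * y + (1 - \<alpha>) * k) + (1 - p) * x"
    "m [Lbbar, La] = p * (\<alpha> * k + (1 - \<alpha>) * x) + (1 - p) * y"
    by (simp_all add: m la \<theta>) (simp_all add: k_x_y_def)
  have "measure (kappa_mix \<alpha> p) A = p * k + (1 - p) * (\<alpha> * x + (1 - \<alpha>) * y)"
    using measure_kappa_mix[OF A p, of \<alpha>] by (simp add: \<theta>) (simp add: k_x_y_def)
  also have "\<dots> = p * k + ((1 - p) * \<alpha>) * x + ((1 - p) * (1 - \<alpha>)) * y"
    by (simp add: algebra_simps)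
  also have "\<dots> = pmf \<mu> [La] * m [La] + pmf \<mu> [Lb] * m [Lb] + pmf \<mu> [Lbbar] * m [Lbbar]
      + pmf \<mu> [Lb, La] * m [Lb, La] + pmf \<mu> [Lbbar, La] * m [Lbbar, La]"
    unfolding ms
    \<comment> \<open>The coefficients of \<open>y\<close>, \<open>x\<close> and \<open>k\<close>
      are replaced in this order. As \<open>p\<close> also occurs elsewhere, only its first
      occurrence, the coefficient of \<open>k\<close>, is rewritten.\<close>
    by (subst eq_bbar, subst eq_b, subst (1) eq_a) (simp add: algebra_simps)
  finally have "ennreal (measure (kappa_mix \<alpha> p) A) = (\<integral>\<^sup>+g. ennreal (m g) \<partial>measure_pmf \<mu>)"
    by (subst nn_integral_step_set[OF \<mu>]) (auto simp: m_def)
  then show "emeasure (kappa_mix \<alpha> p) A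
      = (\<integral>\<^sup>+g. emeasure (kappa_mix \<alpha> p) {\<gamma> \<in> boundary. act g \<gamma> \<in> A} \<partial>measure_pmf \<mu>)"
    by (simp add: K.emeasure_eq_measure m_def)
qed

section \<open>Transience and harmonic measures\<close>

lemma measurable_stake_stream_pmf:
  fixes M :: "'a :: countable pmf"
  shows "stake n \<in> measurable (stream_space (measure_pmf M)) (count_space UNIV)"
  using measurable_stake by (simp cong: measurable_cong_sets sets_stream_space_cong)

text \<open>As a left fold the walk can start at any group element, so the first increment can be
  split off in inductions over all starting points.\<close>

lemma sample_path_foldl:
  "sample_path h n = foldl (\<lambda>g x. foldr letter_mult g x) [] (stake n h)"
  by (induction n) (simp_all add: Gamma_def stake_Suc del: stake.simps(2))

lemma measurable_sample_path:
  "(\<lambda>h. sample_path h n) \<in> measurable (stream_space (measure_pmf \<mu>)) (count_space UNIV)"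
  unfolding sample_path_foldl by (rule measurable_compose[OF measurable_stake_stream_pmf]) simp

lemma reduced_sample_path:
  assumes "\<And>n. h !! n \<in> step_set"
  shows "reduced (sample_path h n)"
  by (induction n) (auto simp: Gamma_def reduced_Nil assms foldr_letter_mult_reduced step_set_reduced)

text \<open>Conditioning on the first increment moves the starting point and leaves n steps; the
  one-step bound then supplies the remaining factor \<open>c\<close>.\<close>

lemma nn_integral_foldl_contraction:
  fixes \<mu> :: "letter list pmf" and F :: "letter list \<Rightarrow> ennreal"
  assumes red: "\<And>h. h \<in> set_pmf \<mu> \<Longrightarrow> reduced h"
    and contr: "\<And>g. reduced g \<Longrightarrow> (\<integral>\<^sup>+h. F (foldr letter_mult g h) \<partial>measure_pmf \<mu>) \<le> c * F g"
    and g: "reduced g"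
  shows "(\<integral>\<^sup>+h. F (foldl (\<lambda>g x. foldr letter_mult g x) g (stake n h)) \<partial>stream_space (measure_pmf \<mu>))
    \<le> c ^ n * F g"
  using g
proof (induction n arbitrary: g)
  case 0
  interpret prob_space "stream_space (measure_pmf \<mu>)" by (rule prob_space_stream_pmf)
  show ?case by (simp add: emeasure_space_1)
next
  case (Suc n)
  let ?W = "stream_space (measure_pmf \<mu>)" and ?m = "\<lambda>g x. foldr letter_mult g x"
  have "(\<integral>\<^sup>+h. F (foldl ?m g (stake (Suc n) h)) \<partial>?W)
      = (\<integral>\<^sup>+x. (\<integral>\<^sup>+h. F (foldl ?m (?m g x) (stake n h)) \<partial>?W) \<partial>measure_pmf \<mu>)"
    by (subst prob_space.nn_integral_stream_space[OF prob_space_measure_pmf])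
      (auto intro!: measurable_compose[OF measurable_stake_stream_pmf] simp del: stake.simps(2),
       simp)
  also have "\<dots> \<le> (\<integral>\<^sup>+x. c ^ n * F (?m g x) \<partial>measure_pmf \<mu>)"
    by (intro nn_integral_mono_AE AE_pmfI Suc.IH foldr_letter_mult_reduced red)
  also have "\<dots> \<le> c ^ n * (c * F g)"
    by (simp add: nn_integral_cmult mult_left_mono contr Suc.prems)
  finally show ?case by (simp add: ac_simps)
qed

text \<open>By monotone convergence the expected sum is bounded by a geometric series, so the sum is
  finite almost everywhere.\<close>

lemma AE_summable_geometric:
  fixes X :: "nat \<Rightarrow> 'a \<Rightarrow> real"
  assumes X: "\<And>n. X n \<in> borel_measurable M" "\<And>n x. 0 \<le> X n x"
    and le: "\<And>n. (\<integral>\<^sup>+x. ennreal (X n x) \<partial>M) \<le> ennreal (c ^ n)"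
    and c: "0 \<le> c" "c < 1"
  shows "AE x in M. summable (\<lambda>n. X n x)"
proof -
  have "(\<integral>\<^sup>+x. (\<Sum>n. ennreal (X n x)) \<partial>M) = (\<Sum>n. \<integral>\<^sup>+x. ennreal (X n x) \<partial>M)"
    using X by (intro nn_integral_suminf) auto
  also have "\<dots> \<le> (\<Sum>n. ennreal (c ^ n))"
    by (intro suminf_le le summableI)
  also have "\<dots> < \<infinity>"
    using c by (subst suminf_ennreal2) (auto simp: summable_geometric)
  finally have "AE x in M. (\<Sum>n. ennreal (X n x)) \<noteq> \<infinity>"
    using X by (intro nn_integral_PInf_AE) auto
  then show ?thesis
    by eventually_elim (use X in \<open>auto intro: summable_suminf_not_top\<close>)
qed

section \<open>Convergence of the paths to a boundary point\<close>

lemma ex_limit_word: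
  assumes step: "\<And>n. g (Suc n) = foldr letter_mult (g n) (h n)" "\<And>n. h n \<in> step_set"
    and red: "\<And>n. reduced (g n)"
    and len: "filterlim (\<lambda>n. length (g n)) at_top sequentially"
  shows "\<exists>\<gamma>\<in>boundary. converges_to_boundary g \<gamma>"
proof -
  \<comment> \<open>A step reaches only the last two letters, so the first k letters are frozen once
    the length stays at least k + 2.\<close>
  have "\<exists>N. \<forall>n\<ge>N. k \<le> length (g n) \<and> take k (g n) = take k (g N)" for k
  proof -
    obtain N where N: "\<And>n. n \<ge> N \<Longrightarrow> k + 2 \<le> length (g n)"
      using len unfolding filterlim_at_top eventually_sequentially by meson
    have "take k (g n) = take k (g N)" if "n \<ge> N" for n
      using that
    proof (induction n rule: dec_induct)
      case (step n)
      then show ?case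
        using take_mult_step[OF red[of n] assms(2)[of n] N[of n]] assms(1)[of n] by simp
    qed simp
    then show ?thesis using N by (intro exI[of _ N]) (metis add_leD1)
  qed
  then obtain N where N: "\<And>k n. n \<ge> N k \<Longrightarrow> k \<le> length (g n) \<and> take k (g n) = take k (g (N k))"
    by metis
  define \<gamma> where "\<gamma> = to_stream (\<lambda>k. g (N (Suc k)) ! k)"
  have \<gamma>: "\<gamma> !! k = g (N (Suc k)) ! k" for k
    by (simp add: \<gamma>_def to_stream_def)
  have conv: "\<forall>\<^sub>F n in sequentially. k \<le> length (g n) \<and> take k (g n) = stake k \<gamma>" for k
  proof (induction k)
    case (Suc k)
    have "\<forall>\<^sub>F n in sequentially. N (Suc k) \<le> n" by (rule eventually_ge_at_top)
    with Suc show ?case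
    proof eventually_elim
      case (elim n)
      have n: "Suc k \<le> length (g n)" "take (Suc k) (g n) = take (Suc k) (g (N (Suc k)))"
        using N[OF elim(2)] by auto
      have "g n ! k = \<gamma> !! k"
        unfolding \<gamma> using arg_cong[OF n(2), of "\<lambda>xs. xs ! k"] by simp
      then show ?case
        using elim(1) n(1) by (simp add: take_Suc_conv_app_nth stake_Suc del: stake.simps(2))
    qed
  qed simp
  \<comment> \<open>Both letters lie in a prefix shared with some reduced
    \<open>g n\<close>.\<close>
  have "alternate (\<gamma> !! i) (\<gamma> !! Suc i)" for i
  proof -
    obtain n where n: "Suc (Suc i) \<le> length (g n)" "take (Suc (Suc i)) (g n) = stake (Suc (Suc i)) \<gamma>"
      using eventually_happens[OF conv[of "Suc (Suc i)"]] by auto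
    have "g n ! j = \<gamma> !! j" if "j < Suc (Suc i)" for j
      using n that by (metis nth_take stake_nth)
    from this[of i] this[of "Suc i"] show ?thesis
      using red[of n] n(1) unfolding reduced_def by (metis Suc_le_eq lessI less_SucI)
  qed
  then have "\<gamma> \<in> boundary" by (simp add: boundary_def)
  with conv show ?thesis unfolding converges_to_boundary_def by blast
qed

text \<open>The limit is read off from countably many events on single letters, which makes it
  measurable without a choice of limit. \<open>Lbbar\<close> is the remaining letter on convergent
  paths and the default on all others.\<close>

definition limit_word :: "(nat \<Rightarrow> letter list) \<Rightarrow> letter stream" where
  "limit_word g = to_stream (\<lambda>k.
     if \<forall>\<^sub>F n in sequentially. k < length (g n) \<and> g n ! k = La then La
     else if \<forall>\<^sub>F n in sequentially. k < length (g n) \<and> g n ! k = Lb then Lb else Lbbar)"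

lemma limit_word_eq:
  assumes "converges_to_boundary g \<gamma>"
  shows "limit_word g = \<gamma>"
proof -
  have ev: "\<forall>\<^sub>F n in sequentially. k < length (g n) \<and> g n ! k = \<gamma> !! k" for k
    using assms[unfolded converges_to_boundary_def, rule_format, of "Suc k"]
    by eventually_elim (metis Suc_le_eq lessI nth_take stake_nth)
  have "(\<forall>\<^sub>F n in sequentially. k < length (g n) \<and> g n ! k = x) \<longleftrightarrow> \<gamma> !! k = x" for k x
  proof
    assume "\<forall>\<^sub>F n in sequentially. k < length (g n) \<and> g n ! k = x"
    then show "\<gamma> !! k = x"
      using ev[of k] eventually_happens[OF eventually_conj] by fastforce
  qed (use ev[of k] in auto)
  then have "limit_word g = to_stream (\<lambda>k. if \<gamma> !! k = La then La else if \<gamma> !! k = Lb then Lb else Lbbar)"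
    unfolding limit_word_def by presburger
  also have "(\<lambda>k. if \<gamma> !! k = La then La else if \<gamma> !! k = Lb then Lb else Lbbar) = snth \<gamma>"
    by (rule ext) (metis letter.exhaust)
  finally show ?thesis by (simp add: to_stream_def flip: stream_smap_nats)
qed

text \<open>The second branch only serves to make the map take values in the boundary everywhere.\<close>

definition limit_map :: "letter list stream \<Rightarrow> letter stream" where
  "limit_map h = (let \<gamma> = limit_word (sample_path h)
     in if \<gamma> \<in> boundary then \<gamma> else coin_word (sconst True))"

lemma measurable_limit_map: "limit_map \<in> measurable (stream_space (measure_pmf \<mu>)) boundary_space"
proof -
  let ?W = "stream_space (measure_pmf \<mu>)"
  have [measurable]: "Measurable.pred ?W (\<lambda>h. k < length (sample_path h n) \<and> sample_path h n ! k = x)"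
    for k n x
    by (rule measurable_compose[OF measurable_sample_path[of n]]) simp
  have [measurable]: "(\<lambda>h. limit_word (sample_path h)) \<in> measurable ?W (stream_space (count_space UNIV))"
  proof (rule measurable_stream_space2)
    fix k
    show "(\<lambda>h. limit_word (sample_path h) !! k) \<in> measurable ?W (count_space UNIV)"
      unfolding limit_word_def to_stream_def eventually_sequentially
      by simp
  qed
  have [measurable]: "Measurable.pred (stream_space (count_space UNIV)) (\<lambda>\<gamma>. \<gamma> \<in> boundary)"
    unfolding boundary_def by simp
  have [measurable]: "Measurable.pred ?W (\<lambda>h. limit_word (sample_path h) \<in> boundary)"
    by (rule measurable_compose[of _ _ "stream_space (count_space UNIV)"]) measurable
  have "limit_map \<in> measurable ?W (stream_space (count_space UNIV))"
    unfolding limit_map_def Let_def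
  proof (rule measurable_If)
    show "{h \<in> space ?W. limit_word (sample_path h) \<in> boundary} \<in> sets ?W" by measurable
  qed (simp_all add: space_stream_space)
  then show ?thesis
    unfolding boundary_space_def
    by (intro measurable_restrict_space2) (auto simp: limit_map_def Let_def coin_word_boundary)
qed

section \<open>The law of the limit point\<close>

lemma boundary_measure_eqI:
  assumes MN: "prob_space M" "prob_space N" "sets M = sets boundary_space" "sets N = sets boundary_space"
    and eq: "\<And>w. emeasure M {\<gamma> \<in> boundary. stake (length w) \<gamma> = w}
      = emeasure N {\<gamma> \<in> boundary. stake (length w) \<gamma> = w}"
  shows "M = N"
proof (rule measure_eqI)
  let ?S = "stream_space (count_space (UNIV :: letter set))"
  have id: "(\<lambda>x. x) \<in> measurable K ?S" if "sets K = sets boundary_space" for K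
    unfolding measurable_cong_sets[OF that refl] boundary_space_def
    by (rule measurable_restrict_space1) simp
  have em: "emeasure (distr K ?S (\<lambda>x. x)) B = emeasure K (boundary \<inter> B)"
    if "sets K = sets boundary_space" "B \<in> sets ?S" for K B
    using sets_eq_imp_space_eq[OF that(1)] that
    by (simp add: emeasure_distr[OF id] space_boundary_space Int_commute)
  \<comment> \<open>Both measures are carried to the space of all streams, where cylinders determine
    a probability measure; the boundary has the trace sigma-algebra.\<close>
  have "distr M ?S (\<lambda>x. x) = distr N ?S (\<lambda>x. x)"
  proof (rule stream_space_eq_sstart[of UNIV])
    fix xs :: "letter list"
    have "boundary \<inter> sstart UNIV xs = {\<gamma> \<in> boundary. stake (length xs) \<gamma> = xs}"
      by (auto simp: sstart_eq list_eq_iff_nth_eq)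
    then show "emeasure (distr M ?S (\<lambda>x. x)) (sstart UNIV xs)
        = emeasure (distr N ?S (\<lambda>x. x)) (sstart UNIV xs)"
      by (simp add: em MN sstart_sets eq)
  qed (auto simp: MN prob_space.prob_space_distr id)
  moreover fix A assume "A \<in> sets M"
  then obtain B where "B \<in> sets ?S" "A = boundary \<inter> B"
    unfolding MN boundary_space_def sets_restrict_space by auto
  ultimately show "emeasure M A = emeasure N A"
    using em[OF MN(3)] em[OF MN(4)] by metis
qed (simp add: MN)

lemma measure_cancelling_le:
  assumes \<alpha>: "0 \<le> \<alpha>" "\<alpha> \<le> 1" and p: "0 \<le> p" "p \<le> 1"
    and g: "reduced g" "k + 2 * m < length g"
  shows "measure (kappa_mix \<alpha> p) {\<gamma> \<in> boundary. stake k (act g \<gamma>) \<noteq> take k g} \<le> max \<alpha> (1 - \<alpha>) ^ m"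
proof -
  interpret K: prob_space "kappa_mix \<alpha> p" by (rule prob_space_kappa_mix[OF p])
  define u where "u = take k g"
  \<comment> \<open>\<open>v\<close> is a nonempty buffer between the prefix \<open>u\<close> and
    the last 2m letters \<open>w\<close>. As long as its first letter survives, \<open>u\<close> is
    left intact; otherwise \<gamma> starts with the inverse of \<open>w\<close>.\<close>
  define v where "v = take (length g - k - 2 * m) (drop k g)"
  define w where "w = drop (length g - k - 2 * m) (drop k g)"
  have g_eq: "g = u @ v @ w" and len: "length u = k" "length w = 2 * m" and v: "v \<noteq> []"
    unfolding u_def v_def w_def append_take_drop_id using g(2) by auto
  have "stake (2 * m) \<gamma> = map letter_inv (rev w)"
    if \<gamma>: "\<gamma> \<in> boundary" "stake k (act g \<gamma>) \<noteq> u" for \<gamma>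
  proof -
    have "shd (act (v @ w) \<gamma>) \<noteq> hd v"
    proof
      assume "shd (act (v @ w) \<gamma>) = hd v"
      then have "act u (act (v @ w) \<gamma>) = u @- act (v @ w) \<gamma>"
        using g(1) v unfolding g_eq by (intro act_eq_shift) (auto simp: reduced_append)
      then show False
        using \<gamma>(2) len(1) by (simp add: g_eq act_append stake_shift)
    qed
    moreover have "reduced (v @ w)" using g(1) by (simp add: g_eq reduced_append)
    ultimately show ?thesis
      using stake_eq_inverse_of_cancelling[OF _ v \<gamma>(1)] len(2) by metis
  qed
  then have "{\<gamma> \<in> boundary. stake k (act g \<gamma>) \<noteq> take k g}
      \<subseteq> {\<gamma> \<in> boundary. stake (2 * m) \<gamma> = map letter_inv (rev w)}"
    by (auto simp: u_def)
  then have "measure (kappa_mix \<alpha> p) {\<gamma> \<in> boundary. stake k (act g \<gamma>) \<noteq> take k g}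
      \<le> measure (kappa_mix \<alpha> p) {\<gamma> \<in> boundary. stake (2 * m) \<gamma> = map letter_inv (rev w)}"
    by (rule K.finite_measure_mono) (simp add: stake_vimage_sets)
  also have "\<dots> \<le> max \<alpha> (1 - \<alpha>) ^ m"
    by (rule measure_kappa_mix_stake_le[OF \<alpha> p])
  finally show ?thesis .
qed

text \<open>Stationarity says that the mass given to \<open>A\<close> by the translate of the
  measure under \<open>g\<close> is a harmonic function of \<open>g\<close>, so its mean along the
  walk stays at the initial value.\<close>

lemma emeasure_stationary_foldl:
  assumes "stationary \<mu> (kappa_mix \<alpha> p)" and A: "A \<in> sets boundary_space"
  shows "emeasure (kappa_mix \<alpha> p) {\<gamma> \<in> boundary. act g \<gamma> \<in> A}
    = (\<integral>\<^sup>+h. emeasure (kappa_mix \<alpha> p)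
        {\<gamma> \<in> boundary. act (foldl (\<lambda>g x. foldr letter_mult g x) g (stake n h)) \<gamma> \<in> A}
      \<partial>stream_space (measure_pmf \<mu>))"
proof (induction n arbitrary: g)
  case 0
  interpret prob_space "stream_space (measure_pmf \<mu>)" by (rule prob_space_stream_pmf)
  show ?case by (simp add: emeasure_space_1)
next
  case (Suc n)
  let ?W = "stream_space (measure_pmf \<mu>)" and ?m = "\<lambda>g x. foldr letter_mult g x"
  let ?F = "\<lambda>g. emeasure (kappa_mix \<alpha> p) {\<gamma> \<in> boundary. act g \<gamma> \<in> A}"
  have "(\<integral>\<^sup>+h. ?F (foldl ?m g (stake (Suc n) h)) \<partial>?W)
      = (\<integral>\<^sup>+x. (\<integral>\<^sup>+h. ?F (foldl ?m (?m g x) (stake n h)) \<partial>?W) \<partial>measure_pmf \<mu>)"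
    by (subst prob_space.nn_integral_stream_space[OF prob_space_measure_pmf])
      (auto intro!: measurable_compose[OF measurable_stake_stream_pmf] simp del: stake.simps(2),
       simp)
  also have "\<dots> = (\<integral>\<^sup>+x. ?F (?m g x) \<partial>measure_pmf \<mu>)"
    by (simp flip: Suc.IH)
  also have "\<dots> = (\<integral>\<^sup>+x. emeasure (kappa_mix \<alpha> p)
      {\<gamma> \<in> boundary. act x \<gamma> \<in> {\<gamma> \<in> boundary. act g \<gamma> \<in> A}} \<partial>measure_pmf \<mu>)"
    by (intro nn_integral_cong arg_cong2[where f=emeasure]) (auto simp: act_mult act_boundary)
  also have "\<dots> = ?F g"
    by (rule assms(1)[unfolded stationary_def, rule_format, OF act_vimage_sets[OF A], symmetric])
  finally show ?case by (rule sym)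
qed

text \<open>For a cylinder \<open>?A\<close>, the masses \<open>u n\<close> have constant mean,
  equal to the stationary mass of \<open>?A\<close>, and converge almost surely to the indicator
  that the limit point lies in \<open>?A\<close>. Dominated convergence equates the law of the limit
  with the stationary measure on cylinders.\<close>

theorem is_harmonic_measure_kappa_mix:
  assumes \<mu>: "set_pmf \<mu> \<subseteq> step_set" and \<alpha>: "0 < \<alpha>" "\<alpha> < 1" and p: "0 \<le> p" "p \<le> 1"
    and stat: "stationary \<mu> (kappa_mix \<alpha> p)"
    and transient: "AE h in stream_space (measure_pmf \<mu>).
      filterlim (\<lambda>n. length (sample_path h n)) at_top sequentially"
  shows "is_harmonic_measure \<mu> (kappa_mix \<alpha> p)"
proof -
  let ?W = "stream_space (measure_pmf \<mu>)" and ?K = "kappa_mix \<alpha> p"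
  interpret W: prob_space ?W by (rule prob_space_stream_pmf)
  interpret K: prob_space ?K by (rule prob_space_kappa_mix[OF p])
  have "AE h in measure_pmf \<mu>. h \<in> step_set" using \<mu> by (auto simp: AE_measure_pmf_iff)
  then have "AE h in ?W. stream_all (\<lambda>x. x \<in> step_set) h"
    by (intro prob_space.AE_stream_all[OF prob_space_measure_pmf]) auto
  with transient have good: "AE h in ?W. (\<forall>n. reduced (sample_path h n)) \<and>
      filterlim (\<lambda>n. length (sample_path h n)) at_top sequentially \<and>
      converges_to_boundary (sample_path h) (limit_map h)"
  proof eventually_elim
    case (elim h)
    then have h: "h !! n \<in> step_set" for n by (simp add: stream_all_def)
    have red: "reduced (sample_path h n)" for n by (rule reduced_sample_path[OF h])
    obtain \<gamma> where "\<gamma> \<in> boundary" "converges_to_boundary (sample_path h) \<gamma>"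
      using ex_limit_word[of "sample_path h" "\<lambda>n. h !! n"] h red elim(1) by (auto simp: mult_Gamma)
    then show ?case
      using red elim(1) by (simp add: limit_map_def limit_word_eq)
  qed
  have "distr ?W boundary_space limit_map = ?K"
  proof (rule boundary_measure_eqI)
    fix w :: "letter list"
    let ?k = "length w"
    let ?A = "{\<gamma> \<in> boundary. stake ?k \<gamma> = w}"
    define u where "u n h = measure ?K {\<gamma> \<in> boundary. act (sample_path h n) \<gamma> \<in> ?A}" for n h
    have u_meas: "u n \<in> borel_measurable ?W" for n
      unfolding u_def by (rule measurable_compose[OF measurable_sample_path]) simp
    have u_le: "u n h \<le> 1" for n h unfolding u_def by simp
    have Z: "limit_map -` ?A \<inter> space ?W \<in> sets ?W"
      by (rule measurable_sets[OF measurable_limit_map stake_vimage_sets])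
    have "AE h in ?W. (\<lambda>n. ennreal (u n h)) \<longlonglongrightarrow> indicator (limit_map -` ?A \<inter> space ?W) h"
      using good
    proof eventually_elim
      case (elim h)
      let ?g = "sample_path h" and ?z = "limit_map h"
      let ?D = "\<lambda>n. {\<gamma> \<in> boundary. stake ?k (act (?g n) \<gamma>) \<noteq> take ?k (?g n)}"
      have red: "reduced (?g n)" for n using elim by blast
      have D_sets: "?D n \<in> sets ?K" for n
      proof -
        let ?E = "{\<gamma> \<in> boundary. act (?g n) \<gamma> \<in> {\<gamma> \<in> boundary. stake ?k \<gamma> = take ?k (?g n)}}"
        have "?D n = space ?K - ?E"
          unfolding space_kappa_mix using act_boundary by blast
        also have "\<dots> \<in> sets ?K"
          by (intro sets.compl_sets) (simp only: sets_kappa_mix act_vimage_sets[OF stake_vimage_sets])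
        finally show ?thesis .
      qed
      have D: "(\<lambda>n. measure ?K (?D n)) \<longlonglongrightarrow> 0"
      proof (rule tendstoI)
        fix e :: real assume "0 < e"
        then obtain m where m: "max \<alpha> (1 - \<alpha>) ^ m < e"
          using real_arch_pow_inv[of e "max \<alpha> (1 - \<alpha>)"] \<alpha> by auto
        \<comment> \<open>The extra letter keeps the buffer in \<open>measure_cancelling_le\<close>
          nonempty.\<close>
        have "\<forall>\<^sub>F n in sequentially. ?k + 2 * m + 1 \<le> length (?g n)"
          using elim unfolding filterlim_at_top by blast
        then show "\<forall>\<^sub>F n in sequentially. dist (measure ?K (?D n)) 0 < e"
        proof eventually_elim
          case (elim n)
          then have "measure ?K (?D n) \<le> max \<alpha> (1 - \<alpha>) ^ m"
            using \<alpha> by (intro measure_cancelling_le red p) auto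
          then show ?case using m by simp
        qed
      qed
      have ev: "\<forall>\<^sub>F n in sequentially. take ?k (?g n) = stake ?k ?z"
        using elim unfolding converges_to_boundary_def by (auto elim: eventually_mono)
      have z: "?z \<in> boundary" by (simp add: limit_map_def Let_def coin_word_boundary)
      \<comment> \<open>Outside \<open>?D n\<close> the translated point has the prefix of
        \<open>?g n\<close>, eventually that of the limit. So \<open>u n h\<close> is the mass of
        the complement of \<open>?D n\<close> if this prefix is \<open>w\<close>, and at most the
        mass of \<open>?D n\<close> otherwise.\<close>
      have "(\<lambda>n. u n h) \<longlonglongrightarrow> indicator (limit_map -` ?A \<inter> space ?W) h"
      proof (cases "stake ?k ?z = w")
        case True
        have "\<forall>\<^sub>F n in sequentially. 1 - measure ?K (?D n) = u n h"
          using ev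
        proof eventually_elim
          case (elim n)
          have "1 - measure ?K (?D n) = measure ?K (space ?K - ?D n)"
            by (rule K.prob_compl[symmetric, OF D_sets])
          also have "space ?K - ?D n = {\<gamma> \<in> boundary. act (?g n) \<gamma> \<in> ?A}"
            using elim True by (auto simp: space_kappa_mix act_boundary)
          finally show ?case by (simp add: u_def)
        qed
        moreover have "(\<lambda>n. 1 - measure ?K (?D n)) \<longlonglongrightarrow> 1 - 0"
          by (intro tendsto_intros D)
        ultimately show ?thesis
          using True z by (auto simp: space_stream_pmf dest: Lim_transform_eventually)
      next
        case False
        have "\<forall>\<^sub>F n in sequentially. u n h \<le> measure ?K (?D n)"
          using ev
        proof eventually_elim
          case (elim n)
          then show ?case
            unfolding u_def using False by (intro K.finite_measure_mono D_sets) auto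
        qed
        then have "(\<lambda>n. u n h) \<longlonglongrightarrow> 0"
          by (rule tendsto_sandwich[OF always_eventually _ tendsto_const D, rotated]) (simp add: u_def)
        then show ?thesis using False by simp
      qed
      then have "(\<lambda>n. ennreal (u n h)) \<longlonglongrightarrow> ennreal (indicator (limit_map -` ?A \<inter> space ?W) h)"
        by (rule tendsto_ennrealI)
      then show ?case by (simp add: ennreal_indicator)
    qed
    moreover have "(\<integral>\<^sup>+h. 1 \<partial>?W) < \<infinity>" by (simp add: W.emeasure_space_1)
    ultimately have "(\<lambda>n. \<integral>\<^sup>+h. ennreal (u n h) \<partial>?W)
        \<longlonglongrightarrow> (\<integral>\<^sup>+h. indicator (limit_map -` ?A \<inter> space ?W) h \<partial>?W)"
      using u_meas Z
      by (intro nn_integral_dominated_convergence[where w="\<lambda>_. 1"]) (auto simp: u_le)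
    moreover have "(\<integral>\<^sup>+h. ennreal (u n h) \<partial>?W) = emeasure ?K ?A" for n
      using emeasure_stationary_foldl[OF stat stake_vimage_sets, of "[]" ?k w n]
      by (simp add: u_def K.emeasure_eq_measure flip: sample_path_foldl)
    ultimately have "emeasure ?K ?A = emeasure ?W (limit_map -` ?A \<inter> space ?W)"
      using Z by (simp add: LIMSEQ_const_iff)
    then show "emeasure (distr ?W boundary_space limit_map) ?A = emeasure ?K ?A"
      by (simp add: emeasure_distr measurable_limit_map stake_vimage_sets)
  qed (auto intro: W.prob_space_distr measurable_limit_map K.prob_space_axioms)
  then show ?thesis
    unfolding is_harmonic_measure_def
    using good measurable_limit_map by (intro bexI[of _ limit_map]) auto
qed

text \<open>The powers of \<open>r\<close> are almost surely summable along the path, hence tend to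
  0. This forces the number of letters a, and with it the length, to infinity.\<close>

lemma transient_of_contraction:
  assumes \<mu>: "set_pmf \<mu> \<subseteq> step_set" and r: "0 < r" "r < (1::real)" and c: "0 \<le> c" "c < 1"
    and contr: "\<And>g. reduced g \<Longrightarrow>
      (\<integral>\<^sup>+h. ennreal (r ^ count_list (foldr letter_mult g h) La) \<partial>measure_pmf \<mu>)
        \<le> ennreal c * ennreal (r ^ count_list g La)"
  shows "AE h in stream_space (measure_pmf \<mu>).
    filterlim (\<lambda>n. length (sample_path h n)) at_top sequentially"
proof -
  let ?W = "stream_space (measure_pmf \<mu>)"
  define X where "X n h = r ^ count_list (sample_path h n) La" for n h
  have "AE h in ?W. summable (\<lambda>n. X n h)"
  proof (rule AE_summable_geometric[OF _ _ _ c])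
    show "X n \<in> borel_measurable ?W" for n
      unfolding X_def by (rule measurable_compose[OF measurable_sample_path]) simp
    show "0 \<le> X n h" for n h using r by (simp add: X_def)
    show "(\<integral>\<^sup>+h. ennreal (X n h) \<partial>?W) \<le> ennreal (c ^ n)" for n
      unfolding X_def sample_path_foldl
      using nn_integral_foldl_contraction[of \<mu> "\<lambda>g. ennreal (r ^ count_list g La)" "ennreal c" "[]" n]
        \<mu> step_set_reduced contr reduced_Nil c
      by (auto simp: ennreal_power)
  qed
  then show ?thesis
  proof eventually_elim
    case (elim h)
    show ?case
      unfolding filterlim_at_top
    proof
      fix k
      have "\<forall>\<^sub>F n in sequentially. X n h < r ^ k"
        using summable_LIMSEQ_zero[OF elim] r by (intro order_tendstoD) auto
      then show "\<forall>\<^sub>F n in sequentially. k \<le> length (sample_path h n)"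
      proof eventually_elim
        case (elim n)
        then have "k < count_list (sample_path h n) La"
          using r by (simp add: X_def)
        then show ?case using count_le_length[of "sample_path h n" La] by linarith
      qed
    qed
  qed
qed

section \<open>Minkowski class and singularity\<close>

text \<open>Both weights of the mixture are positive, so its null sets are the common null sets of
  the two components, whatever the weights.\<close>

lemma kappa_mix_half_minkowski:
  assumes "0 < p" "p < 1"
  shows "kappa_mix (1/2) p \<in> minkowski_class"
proof -
  have null: "A \<in> null_sets (kappa_mix (1/2) q) \<longleftrightarrow> A \<in> sets boundary_space \<and>
      emeasure (coins (1/2)) {\<omega>. coin_word \<omega> \<in> A} = 0 \<and>
      emeasure (coins (1/2)) {\<omega>. stl (coin_word \<omega>) \<in> A} = 0" if "0 < q" "q < 1" for A q
    using that
    by (cases "A \<in> sets boundary_space") (auto simp: null_sets_def emeasure_kappa_mix_coins)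
  then have "null_sets (kappa_mix (1/2) p) = null_sets (kappa_mix (1/2) q)" if "0 < q" "q < 1" for q
    using assms that by (simp add: set_eq_iff)
  then show ?thesis
    by (auto simp: minkowski_class_def equivalent_measures_def absolutely_continuous_def)
qed

section \<open>Separating a biased coin from the fair one\<close>

lemma nn_integral_prod_stake:
  fixes M :: "'a :: countable pmf" and f :: "'a \<Rightarrow> ennreal"
  shows "(\<integral>\<^sup>+\<omega>. prod_list (map f (stake n \<omega>)) \<partial>stream_space (measure_pmf M))
    = (\<integral>\<^sup>+x. f x \<partial>measure_pmf M) ^ n"
proof (induction n)
  case 0
  interpret prob_space "stream_space (measure_pmf M)" by (rule prob_space_stream_pmf)
  show ?case by (simp add: emeasure_space_1)
next
  case (Suc n)
  have meas: "(\<lambda>\<omega>. g (stake k \<omega>)) \<in> borel_measurable (stream_space (measure_pmf M))"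
    for g :: "'a list \<Rightarrow> ennreal" and k
    by (rule measurable_compose[OF measurable_stake_stream_pmf]) simp
  show ?case
    by (subst prob_space.nn_integral_stream_space[OF prob_space_measure_pmf meas])
      (simp add: nn_integral_cmult meas nn_integral_multc Suc.IH)
qed

text \<open>The left side is the Hellinger affinity of the \<alpha>-coin and the fair coin; it is
  below 1 because the square of \<open>sqrt \<alpha> - sqrt (1 - \<alpha>)\<close> is strictly
  positive.\<close>

lemma sqrt_half_sum_less_1:
  assumes "0 < \<alpha>" "\<alpha> < 1" "\<alpha> \<noteq> 1/2"
  shows "sqrt (\<alpha> / 2) + sqrt ((1 - \<alpha>) / 2) < 1"
proof -
  have "(sqrt \<alpha> - sqrt (1 - \<alpha>))\<^sup>2 > 0"
    using assms by simp
  then have "2 * (sqrt \<alpha> * sqrt (1 - \<alpha>)) < 1"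
    using assms by (simp add: power2_diff)
  then have "(sqrt (\<alpha> / 2) + sqrt ((1 - \<alpha>) / 2))\<^sup>2 < 1\<^sup>2"
    using assms by (simp add: power2_sum real_sqrt_divide field_simps)
  then show ?thesis by (rule power2_less_imp_less) simp
qed

text \<open>The square root of the likelihood ratio of the fair coin with respect to the \<open>\<alpha>\<close>-coin:
  the expectation of its products decays exponentially under the \<open>\<alpha>\<close>-coin, and so does that of
  the reciprocal products under the fair coin, both at the rate given by the Hellinger affinity.\<close>

definition sqrt_ratio :: "real \<Rightarrow> bool \<Rightarrow> real" where
  "sqrt_ratio \<alpha> c = sqrt (1 / 2 / (if c then \<alpha> else 1 - \<alpha>))"

lemma AE_summable_prod_stake:
  fixes f :: "bool \<Rightarrow> real"
  assumes \<alpha>: "0 \<le> \<alpha>" "\<alpha> \<le> 1" and f: "\<And>c. 0 \<le> f c" "f True * \<alpha> + f False * (1 - \<alpha>) < 1"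
  shows "AE \<omega> in coins \<alpha>. summable (\<lambda>n. prod_list (map f (stake n \<omega>)))"
proof (rule AE_summable_geometric)
  have nonneg: "0 \<le> prod_list (map f xs)" for xs using f by (induction xs) auto
  then show "0 \<le> prod_list (map f (stake n \<omega>))" for n \<omega> .
  show "(\<lambda>\<omega>. prod_list (map f (stake n \<omega>))) \<in> borel_measurable (coins \<alpha>)" for n
    by (rule measurable_compose[OF measurable_stake_stream_pmf]) simp
  have *: "ennreal (prod_list (map f xs)) = prod_list (map (\<lambda>c. ennreal (f c)) xs)" for xs
    using f nonneg by (induction xs) (auto simp: ennreal_mult)
  have "(\<integral>\<^sup>+\<omega>. ennreal (prod_list (map f (stake n \<omega>))) \<partial>coins \<alpha>)
      = (ennreal (f True * \<alpha> + f False * (1 - \<alpha>))) ^ n" for n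
    using \<alpha> f(1) unfolding * nn_integral_prod_stake by (simp add: ennreal_mult ennreal_plus)
  then show "(\<integral>\<^sup>+\<omega>. ennreal (prod_list (map f (stake n \<omega>))) \<partial>coins \<alpha>)
      \<le> ennreal ((f True * \<alpha> + f False * (1 - \<alpha>)) ^ n)" for n
    using \<alpha> f(1) by (simp add: ennreal_power del: ennreal_plus)
  show "0 \<le> f True * \<alpha> + f False * (1 - \<alpha>)" using \<alpha> f(1) by simp
qed (rule f(2))

text \<open>Under the fair coin the reciprocal products are summable. If the products were summable
  too, both sequences would tend to 0, although their termwise product is 1.\<close>

lemma AE_summable_sqrt_ratio:
  assumes "0 < \<alpha>" "\<alpha> < 1" "\<alpha> \<noteq> 1/2"
  shows "AE \<omega> in coins \<alpha>. summable (\<lambda>n. prod_list (map (sqrt_ratio \<alpha>) (stake n \<omega>)))"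
    and "AE \<omega> in coins (1/2). \<not> summable (\<lambda>n. prod_list (map (sqrt_ratio \<alpha>) (stake n \<omega>)))"
proof -
  let ?f = "sqrt_ratio \<alpha>" and ?g = "\<lambda>c. inverse (sqrt_ratio \<alpha> c)"
  have affinity: "sqrt (1 / 2 / x) * x = sqrt (x / 2)" "inverse (sqrt (1 / 2 / x)) * (1/2) = sqrt (x / 2)"
    if "0 < x" for x :: real
    using that
    by (intro real_sqrt_unique[symmetric];
        simp add: power_mult_distrib real_sqrt_pow2 power_inverse power2_eq_square[of x] power2_eq_square[of "2::real"] field_simps)+
  have pos: "0 < ?f c" for c using assms by (simp add: sqrt_ratio_def)
  have "?f True * \<alpha> + ?f False * (1 - \<alpha>) = sqrt (\<alpha> / 2) + sqrt ((1 - \<alpha>) / 2)"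
    using assms affinity(1)[of \<alpha>] affinity(1)[of "1 - \<alpha>"] by (simp only: sqrt_ratio_def if_True if_False)
  then show "AE \<omega> in coins \<alpha>. summable (\<lambda>n. prod_list (map ?f (stake n \<omega>)))"
    using assms pos sqrt_half_sum_less_1[OF assms]
    by (intro AE_summable_prod_stake) (auto simp: less_imp_le)
  have "?g True * (1/2) + ?g False * (1 - 1/2) = sqrt (\<alpha> / 2) + sqrt ((1 - \<alpha>) / 2)"
    using assms affinity(2)[of \<alpha>] affinity(2)[of "1 - \<alpha>"] by (simp add: sqrt_ratio_def)
  then have "AE \<omega> in coins (1/2). summable (\<lambda>n. prod_list (map ?g (stake n \<omega>)))"
    using pos sqrt_half_sum_less_1[OF assms]
    by (intro AE_summable_prod_stake) (auto simp: less_imp_le)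
  then show "AE \<omega> in coins (1/2). \<not> summable (\<lambda>n. prod_list (map ?f (stake n \<omega>)))"
  proof eventually_elim
    case (elim \<omega>)
    show ?case
    proof
      assume "summable (\<lambda>n. prod_list (map ?f (stake n \<omega>)))"
      then have "(\<lambda>n. prod_list (map ?f (stake n \<omega>)) * prod_list (map ?g (stake n \<omega>))) \<longlonglongrightarrow> 0 * 0"
        using elim by (intro tendsto_mult summable_LIMSEQ_zero)
      moreover have "prod_list (map ?f xs) * prod_list (map ?g xs) = 1" for xs
      proof (induction xs)
        case (Cons c xs)
        have "prod_list (map ?f (c # xs)) * prod_list (map ?g (c # xs))
            = (?f c * ?g c) * (prod_list (map ?f xs) * prod_list (map ?g xs))"
          by simp
        then show ?case using pos[of c] Cons.IH by simp
      qed simp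
      ultimately show False by (simp add: LIMSEQ_const_iff)
    qed
  qed
qed

text \<open>Branching on the first letter gives a common left inverse for both components of the
  mixture, so one event about coins can be tested on either.\<close>

definition decode :: "letter stream \<Rightarrow> bool stream" where
  "decode \<gamma> = to_stream (\<lambda>i. if \<gamma> !! 0 = La then \<gamma> !! (2 * i + 1) = Lb else \<gamma> !! (2 * i) = Lb)"

lemma decode_coin_word: "decode (coin_word \<omega>) = \<omega>" "decode (stl (coin_word \<omega>)) = \<omega>"
proof -
  have "stl (coin_word \<omega>) !! i = coin_word \<omega> !! Suc i" for i by simp
  then have "(\<lambda>i. if coin_word \<omega> !! 0 = La then coin_word \<omega> !! (2 * i + 1) = Lb
        else coin_word \<omega> !! (2 * i) = Lb) = snth \<omega>"
      "(\<lambda>i. if stl (coin_word \<omega>) !! 0 = La then stl (coin_word \<omega>) !! (2 * i + 1) = Lb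
        else stl (coin_word \<omega>) !! (2 * i) = Lb) = snth \<omega>"
    by (auto simp: coin_word_snth fun_eq_iff simp del: snth.simps)
  then show "decode (coin_word \<omega>) = \<omega>" "decode (stl (coin_word \<omega>)) = \<omega>"
    unfolding decode_def to_stream_def by (simp_all only: stream_smap_nats[symmetric])
qed

lemma measurable_decode: "decode \<in> measurable boundary_space (stream_space (count_space UNIV))"
  unfolding boundary_space_def
proof (intro measurable_restrict_space1 measurable_stream_space2)
  fix i
  show "(\<lambda>\<gamma>. decode \<gamma> !! i) \<in> measurable (stream_space (count_space UNIV)) (count_space UNIV)"
    unfolding decode_def to_stream_def by simp
qed

text \<open>Summability of the decoded likelihood products separates the two measures. One
  representative of the class suffices, since every member vanishes on its null sets.\<close>

lemma kappa_mix_singular: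
  assumes \<alpha>: "0 < \<alpha>" "\<alpha> < 1" "\<alpha> \<noteq> 1/2"
  shows "singular_to_class (kappa_mix \<alpha> p) minkowski_class"
  unfolding singular_to_class_def
proof
  fix m assume "m \<in> minkowski_class"
  then have "\<forall>q. 0 < q \<and> q < 1 \<longrightarrow> equivalent_measures m (kappa_mix (1/2) q)"
    by (simp add: minkowski_class_def)
  then have "equivalent_measures m (kappa_mix (1/2) (1/2))"
    by (elim allE[of _ "1/2"]) simp
  then have m: "sets m = sets boundary_space" "null_sets (kappa_mix (1/2) (1/2)) \<subseteq> null_sets m"
    by (auto simp: equivalent_measures_def absolutely_continuous_def)
  let ?P = "\<lambda>\<omega>. summable (\<lambda>n. prod_list (map (sqrt_ratio \<alpha>) (stake n \<omega>)))"
  have [measurable]: "(\<lambda>\<omega>. prod_list (map (sqrt_ratio \<alpha>) (stake n \<omega>)))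
      \<in> borel_measurable (stream_space (count_space UNIV))" for n
    by (rule measurable_compose[OF measurable_stake]) simp
  have P: "Measurable.pred (stream_space (count_space UNIV)) ?P"
    unfolding summable_iff_convergent Cauchy_convergent_iff[symmetric] Measurable.pred_def
    by (intro sets_Collect_Cauchy) simp
  define A where "A = {\<gamma> \<in> boundary. \<not> ?P (decode \<gamma>)}"
  have D: "Measurable.pred boundary_space (\<lambda>\<gamma>. \<not> ?P (decode \<gamma>))"
    using measurable_compose[OF measurable_decode P] by simp
  have "{\<gamma> \<in> space boundary_space. \<not> ?P (decode \<gamma>)} \<in> sets boundary_space"
    "{\<gamma> \<in> space boundary_space. \<not> \<not> ?P (decode \<gamma>)} \<in> sets boundary_space"
    using D by measurable
  then have A: "A \<in> sets boundary_space" "boundary - A \<in> sets boundary_space"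
    by (simp_all add: A_def space_boundary_space set_diff_eq) (simp_all cong: conj_cong)
  have coins: "{\<omega>. coin_word \<omega> \<in> A} = {\<omega>. \<not> ?P \<omega>}" "{\<omega>. stl (coin_word \<omega>) \<in> A} = {\<omega>. \<not> ?P \<omega>}"
    "{\<omega>. coin_word \<omega> \<in> boundary - A} = {\<omega>. ?P \<omega>}" "{\<omega>. stl (coin_word \<omega>) \<in> boundary - A} = {\<omega>. ?P \<omega>}"
    by (simp_all add: A_def decode_coin_word coin_word_boundary stl_coin_word_boundary)
  have 0: "emeasure (coins \<alpha>) {\<omega>. \<not> ?P \<omega>} = 0" "emeasure (coins (1/2)) {\<omega>. ?P \<omega>} = 0"
    using AE_summable_sqrt_ratio[OF \<alpha>] coin_word_vimage_sets(1)[OF A(1), of \<alpha>]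
      coin_word_vimage_sets(1)[OF A(2), of "1/2"]
    unfolding coins by (simp_all add: AE_iff_measurable[OF _ refl] space_stream_pmf)
  have "emeasure (kappa_mix \<alpha> p) A = 0"
    using 0 by (simp add: emeasure_kappa_mix_coins A coins)
  moreover have "emeasure m (space m - A) = 0"
  proof -
    have "boundary - A \<in> null_sets (kappa_mix (1/2) (1/2))"
      using 0 A unfolding null_sets_def mem_Collect_eq emeasure_kappa_mix_coins[OF A(2)] coins by simp
    moreover have "space m = boundary"
      using sets_eq_imp_space_eq[OF m(1)] by (simp add: space_boundary_space)
    ultimately show ?thesis using m(2) by auto
  qed
  ultimately show "mutually_singular (kappa_mix \<alpha> p) m"
    using A m(1) by (auto simp: mutually_singular_def)
qed

section \<open>A segment of step distributions\<close>

text \<open>Multiplying ba and its counterpart by a on the right gives the single letters, the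
  square of a gives the identity, and every reduced word is a product of its letters.\<close>

lemma non_degenerateI:
  assumes "set_pmf \<mu> \<subseteq> step_set" "{[La], [Lb, La], [Lbbar, La]} \<subseteq> set_pmf \<mu>"
  shows "non_degenerate \<mu>"
proof -
  let ?S = "semigroup_span Gamma (set_pmf \<mu>)"
  interpret group Gamma by (rule group_Gamma)
  have mult: "foldr letter_mult u v \<in> ?S" if "u \<in> ?S" "v \<in> ?S" for u v
    using semigroup_span.mult[OF that] by (simp add: mult_Gamma)
  have gens: "[La] \<in> ?S" "[Lb, La] \<in> ?S" "[Lbbar, La] \<in> ?S"
    using assms(2) by (auto intro: semigroup_span.incl)
  have letters: "[x] \<in> ?S" for x
    using gens(1) mult[OF gens(2,1)] mult[OF gens(3,1)] by (cases x) simp_all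
  have "w \<in> ?S" if "reduced w" for w
    using that
  proof (induction w)
    case Nil
    then show ?case using mult[OF gens(1,1)] by simp
  next
    case (Cons x w)
    then have "foldr letter_mult [x] w \<in> ?S"
      by (intro mult letters) (simp add: reduced_Cons)
    then show ?case
      using foldr_letter_mult_append[of "[x]" w] Cons.prems by simp
  qed
  moreover have "w \<in> carrier Gamma" if "w \<in> ?S" for w
    using that
    by induction (use assms(1) in \<open>auto simp: carrier_Gamma step_set_reduced\<close>,
        auto simp: mult_Gamma foldr_letter_mult_reduced)
  ultimately show ?thesis
    by (auto simp: non_degenerate_def carrier_Gamma)
qed

text \<open>The measures with these weights form the segment from \<open>\<mu>\<^sub>1\<close> (at \<open>s = 0\<close>) to \<open>\<mu>\<^sub>2\<close>
  (at \<open>s = 1\<close>).\<close>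

definition segment_weights :: "real \<Rightarrow> letter list pmf \<Rightarrow> bool" where
  "segment_weights s \<mu> \<longleftrightarrow> set_pmf \<mu> \<subseteq> step_set \<and> pmf \<mu> [La] = 1/5 \<and> pmf \<mu> [Lb] = 2/5 * s \<and>
     pmf \<mu> [Lbbar] = 0 \<and> pmf \<mu> [Lb, La] = (2 - s) / 5 \<and> pmf \<mu> [Lbbar, La] = (2 - s) / 5"

text \<open>Only one step can remove an a from a word ending in a power of b: the one among ba and
  its counterpart that first cancels the last letter. It costs a factor 4/3 with weight
  \<open>(2 - s) / 5\<close>, and the total is at most 59/60 - s/60. The empty word and a last
  letter a give smaller factors.\<close>

lemma count_La_contraction:
  fixes s :: real
  defines "f \<equiv> \<lambda>g. (3/4) ^ count_list g La :: real"
  assumes g: "reduced g" and s: "0 \<le> s" "s \<le> 1"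
  shows "1/5 * f (foldr letter_mult g [La]) + 2/5 * s * f (foldr letter_mult g [Lb])
    + (2 - s) / 5 * f (foldr letter_mult g [Lb, La]) + (2 - s) / 5 * f (foldr letter_mult g [Lbbar, La])
    \<le> 59/60 * f g"
proof (cases g rule: rev_cases)
  case Nil
  then show ?thesis using s by (simp add: f_def field_simps)
next
  case (snoc u x)
  have u: "reduced u" "u = [] \<or> alternate (last u) x"
    using g by (auto simp: snoc reduced_append)
  have app: "foldr letter_mult u w = u @ w" if "reduced (u @ w)" for w
    using that by (rule foldr_letter_mult_append)
  have F: "0 \<le> f u" by (simp add: f_def)
  have sF: "0 \<le> s * f u" "s * f u \<le> f u"
    using s F mult_right_mono[of s 1 "f u"] by auto
  \<comment> \<open>Here \<open>u\<close> is empty or ends in a; in the second case that a cancels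
    and the power of 3/4 drops by one.\<close>
  have La: "f (foldr letter_mult u [La]) \<le> 4/3 * f u" if "x \<noteq> La"
  proof (cases u rule: rev_cases)
    case Nil
    then show ?thesis by (simp add: f_def)
  next
    case (snoc v y)
    with u that have "y = La" "reduced v" by (auto simp: reduced_append)
    then show ?thesis using snoc foldr_letter_mult_Nil[of v] by (simp add: f_def)
  qed
  have "(2 - s) / 5 * f (foldr letter_mult u [La]) \<le> (2 - s) / 5 * (4/3 * f u)" if "x \<noteq> La"
    using La[OF that] s by (intro mult_left_mono) auto
  note G = this
  have vals: "f g = (if x = La then 3/4 * f u else f u)"
    "f (foldr letter_mult g [La]) = (if x = La then f u else 3/4 * f u)"
    "f (foldr letter_mult g [Lb]) = (if x = Lbbar then f u else f g)"
    "f (foldr letter_mult g [Lb, La]) = (if x = Lbbar then f (foldr letter_mult u [La]) else 3/4 * f g)"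
    "f (foldr letter_mult g [Lbbar, La]) = (if x = Lb then f (foldr letter_mult u [La]) else 3/4 * f g)"
    using u
    by (cases x; simp add: f_def snoc app reduced_append reduced_Cons reduced_Nil foldr_letter_mult_Nil)+
  show ?thesis
  proof (cases "x = La")
    case True
    have "1/5 * f u + 2/5 * s * (3/4 * f u) + (2 - s) / 5 * (3/4 * (3/4 * f u)) + (2 - s) / 5 * (3/4 * (3/4 * f u))
        = 13/20 * f u + 3/40 * (s * f u)"
      by (simp add: field_simps)
    with True show ?thesis
      unfolding vals using sF F by simp
  next
    case False
    have "1/5 * (3/4 * f u) + 2/5 * s * f u + (2 - s) / 5 * (3/4 * f u) + (2 - s) / 5 * (4/3 * f u)
        = 59/60 * f u - s * f u / 60"
      by (simp add: field_simps)
    then have le: "1/5 * (3/4 * f u) + 2/5 * s * f u + (2 - s) / 5 * (3/4 * f u)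
        + (2 - s) / 5 * f (foldr letter_mult u [La]) \<le> 59/60 * f u"
      using sF G[OF False] by linarith
    consider "x = Lb" | "x = Lbbar" using False by (cases x) auto
    then show ?thesis
    proof cases
      case 1
      then show ?thesis unfolding vals using le by simp
    next
      case 2
      then show ?thesis unfolding vals using le by simp
    qed
  qed
qed

text \<open>The formula for \<open>p\<close> solves the first stationarity equation, which is linear in \<open>p\<close>; the
  quadratic equation for \<open>\<alpha>\<close> is what remains of the second one.\<close>

lemma harmonic_measure_segment:
  assumes \<mu>: "segment_weights s \<mu>" and s: "0 \<le> s" "s \<le> 1" and \<alpha>: "0 < \<alpha>" "\<alpha> < 1"
    and p: "p = (1 + 2 * s * (1 - \<alpha>)) / (4 + s + 2 * s * (1 - \<alpha>))"
    and eq: "5 * (3 + s) * \<alpha> = (1 + 2 * s * (1 - \<alpha>)) * (2 * s + \<alpha> + (2 - s) * (1 - \<alpha>)) + (2 - s) * (3 + s)"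
  shows "is_harmonic_measure \<mu> (kappa_mix \<alpha> p)"
proof (rule is_harmonic_measure_kappa_mix)
  have w: "set_pmf \<mu> \<subseteq> step_set" "pmf \<mu> [La] = 1/5" "pmf \<mu> [Lb] = 2/5 * s" "pmf \<mu> [Lbbar] = 0"
    "pmf \<mu> [Lb, La] = (2 - s) / 5" "pmf \<mu> [Lbbar, La] = (2 - s) / 5"
    using \<mu> by (auto simp: segment_weights_def)
  then show "set_pmf \<mu> \<subseteq> step_set" by simp
  define v where "v = s * (1 - \<alpha>)"
  have v: "0 \<le> v" using s \<alpha> by (simp add: v_def)
  define D where "D = 4 + s + 2 * v"
  have D: "D > 0" using s v by (simp add: D_def)
  have p_eq: "p = (1 + 2 * v) / D" "1 - p = (3 + s) / D"
    using D unfolding p by (simp_all add: v_def D_def field_simps)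
  then show p01: "0 \<le> p" "p \<le> 1" using D v s by (auto simp: D_def)
  show "stationary \<mu> (kappa_mix \<alpha> p)"
  proof (rule stationary_kappa_mix)
    have eq': "5 * (3 + s) * \<alpha> = (1 + 2 * v) * (2 * s + \<alpha> + (2 - s) * (1 - \<alpha>)) + (2 - s) * (3 + s)"
      unfolding eq by (simp only: v_def mult.assoc)
    have "5 * ((1 - p) * \<alpha>) = 5 * (3 + s) * \<alpha> / D"
      by (simp only: p_eq(2)) simp
    also have "\<dots> = p * (2 * s + \<alpha> + (2 - s) * (1 - \<alpha>)) + (2 - s) * (1 - p)"
      unfolding eq' p_eq(2) unfolding p_eq(1) using D by (simp add: field_simps)
    finally show "(1 - p) * \<alpha> = pmf \<mu> [La] * p * \<alpha> + pmf \<mu> [Lb] * p + pmf \<mu> [Lbbar] * (1 - p) * (1 - \<alpha>)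
        + pmf \<mu> [Lb, La] * (1 - p) + pmf \<mu> [Lbbar, La] * p * (1 - \<alpha>)"
      by (simp add: w field_simps)
    have "p * D = 1 + 2 * v" using D by (simp add: p_eq)
    then show "p = pmf \<mu> [La] * (1 - p) + (pmf \<mu> [Lb] * (1 - \<alpha>) + pmf \<mu> [Lbbar] * \<alpha>) * (1 - p)
        + (pmf \<mu> [Lb, La] * (1 - \<alpha>) + pmf \<mu> [Lbbar, La] * \<alpha>) * p"
      by (simp add: w D_def v_def field_simps)
  qed (use \<alpha> p01 w in auto)
  show "AE h in stream_space (measure_pmf \<mu>).
      filterlim (\<lambda>n. length (sample_path h n)) at_top sequentially"
  proof (rule transient_of_contraction[of _ "3/4" "59/60"])
    fix g assume "reduced g"
    from count_La_contraction[OF this s]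
    show "(\<integral>\<^sup>+h. ennreal ((3/4) ^ count_list (foldr letter_mult g h) La) \<partial>measure_pmf \<mu>)
        \<le> ennreal (59/60) * ennreal ((3/4) ^ count_list g La)"
      by (subst nn_integral_step_set[OF w(1)]) (simp_all add: w flip: ennreal_mult)
  qed (use w in auto)
qed (use \<alpha> in auto)

section \<open>Endpoints and interior of the segment\<close>

lemma harmonic_measure_segment_endpoint:
  assumes "segment_weights s \<mu>" "s = 0 \<or> s = 1"
  shows "\<exists>\<nu>. is_harmonic_measure \<mu> \<nu> \<and> \<nu> \<in> minkowski_class"
proof -
  have "is_harmonic_measure \<mu> (kappa_mix (1/2) ((1 + s) / (4 + 2 * s)))"
    \<comment> \<open>At \<alpha> = 1/2 the two sides of the quadratic equation differ by s(1 -
      s)/2, which vanishes at both endpoints.\<close>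
    using assms by (intro harmonic_measure_segment) auto
  moreover have "kappa_mix (1/2) ((1 + s) / (4 + 2 * s)) \<in> minkowski_class"
    using assms(2) by (intro kappa_mix_half_minkowski) auto
  ultimately show ?thesis by blast
qed

text \<open>The defect \<Phi> of the quadratic equation changes sign between 0 and 1, so some
  \<alpha> in between is a root. Its value s(1 - s)/2 at 1/2 is nonzero, so the corresponding coin
  is not fair.\<close>

lemma harmonic_measure_segment_interior:
  assumes "segment_weights s \<mu>" "0 < s" "s < 1"
  shows "\<exists>\<nu>. is_harmonic_measure \<mu> \<nu> \<and> singular_to_class \<nu> minkowski_class"
proof -
  define \<Phi> where "\<Phi> \<alpha> = 5 * (3 + s) * \<alpha>
    - (1 + 2 * s * (1 - \<alpha>)) * (2 * s + \<alpha> + (2 - s) * (1 - \<alpha>)) - (2 - s) * (3 + s)" for \<alpha>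
  have "\<Phi> 0 = - ((1 + 2 * s) * (2 + s) + (2 - s) * (3 + s))" by (simp add: \<Phi>_def)
  also have "\<dots> < 0" using assms(2,3) by (intro neg_less_0_iff_less[THEN iffD2] add_pos_pos mult_pos_pos) auto
  finally have 0: "\<Phi> 0 < 0" .
  have "\<Phi> 1 = 8 + 4 * s + s * s" by (simp add: \<Phi>_def algebra_simps)
  also have "\<dots> > 0" using assms(2,3) by (simp add: add_pos_pos)
  finally have 1: "\<Phi> 1 > 0" .
  have "\<Phi> (1/2) = s * (1 - s) / 2" by (simp add: \<Phi>_def field_simps)
  also have "\<dots> \<noteq> 0" using assms(2,3) by simp
  finally have half: "\<Phi> (1/2) \<noteq> 0" .
  have "continuous_on {0..1} \<Phi>" unfolding \<Phi>_def by (intro continuous_intros)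
  then obtain \<alpha> where \<alpha>: "0 \<le> \<alpha>" "\<alpha> \<le> 1" "\<Phi> \<alpha> = 0"
    using IVT'[of \<Phi> 0 0 1] 0 1 by auto
  have "\<alpha> \<noteq> 0" "\<alpha> \<noteq> 1" "\<alpha> \<noteq> 1/2" using 0 1 half \<alpha>(3) by (metis less_irrefl)+
  with \<alpha> have "0 < \<alpha>" "\<alpha> < 1" "\<alpha> \<noteq> 1/2" by simp_all
  moreover from this have
    "is_harmonic_measure \<mu> (kappa_mix \<alpha> ((1 + 2 * s * (1 - \<alpha>)) / (4 + s + 2 * s * (1 - \<alpha>))))"
    using assms \<alpha>(3) by (intro harmonic_measure_segment) (auto simp: \<Phi>_def)
  ultimately show ?thesis using kappa_mix_singular by blast
qed

theorem mainTheorem3: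
  shows "\<exists>\<mu>\<^sub>1 \<mu>\<^sub>2. set_pmf \<mu>\<^sub>1 \<subseteq> step_set \<and> set_pmf \<mu>\<^sub>2 \<subseteq> step_set \<and>
     non_degenerate \<mu>\<^sub>1 \<and> non_degenerate \<mu>\<^sub>2 \<and>
     (\<exists>\<nu>\<^sub>1. is_harmonic_measure \<mu>\<^sub>1 \<nu>\<^sub>1 \<and> \<nu>\<^sub>1 \<in> minkowski_class) \<and>
     (\<exists>\<nu>\<^sub>2. is_harmonic_measure \<mu>\<^sub>2 \<nu>\<^sub>2 \<and> \<nu>\<^sub>2 \<in> minkowski_class) \<and>
     (\<forall>t. 0 < t \<and> t < 1 \<longrightarrow>
        (\<exists>\<nu>. is_harmonic_measure (convex_comb_pmf t \<mu>\<^sub>1 \<mu>\<^sub>2) \<nu> \<and>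
             singular_to_class \<nu> minkowski_class))"
proof -
  \<comment> \<open>Five elements with multiplicity encode weights that are multiples of
    1/5.\<close>
  define \<mu>\<^sub>1 where "\<mu>\<^sub>1 = pmf_of_multiset {#[La], [Lb, La], [Lb, La], [Lbbar, La], [Lbbar, La]#}"
  define \<mu>\<^sub>2 where "\<mu>\<^sub>2 = pmf_of_multiset {#[La], [Lb], [Lb], [Lb, La], [Lbbar, La]#}"
  have \<mu>: "segment_weights 0 \<mu>\<^sub>1" "segment_weights 1 \<mu>\<^sub>2"
    by (simp_all add: segment_weights_def \<mu>\<^sub>1_def \<mu>\<^sub>2_def step_set_def)
  have supp: "set_pmf \<mu>\<^sub>1 \<subseteq> step_set" "set_pmf \<mu>\<^sub>2 \<subseteq> step_set"
    using \<mu> by (simp_all add: segment_weights_def)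
  have nd: "non_degenerate \<mu>\<^sub>1" "non_degenerate \<mu>\<^sub>2"
    using supp by (auto intro!: non_degenerateI simp: \<mu>\<^sub>1_def \<mu>\<^sub>2_def)
  \<comment> \<open>The parameter is reversed because \<open>t\<close> weighs
    \<open>\<mu>\<^sub>1\<close>, the endpoint at s = 0.\<close>
  have "segment_weights (1 - t) (convex_comb_pmf t \<mu>\<^sub>1 \<mu>\<^sub>2)" if "0 < t" "t < 1" for t
  proof -
    have "set_pmf (convex_comb_pmf t \<mu>\<^sub>1 \<mu>\<^sub>2) \<subseteq> step_set"
      using supp by (auto simp: convex_comb_pmf_def split: if_splits)
    then show ?thesis
      using \<mu> that by (auto simp: segment_weights_def pmf_convex_comb field_simps)
  qed
  then have "\<exists>\<nu>. is_harmonic_measure (convex_comb_pmf t \<mu>\<^sub>1 \<mu>\<^sub>2) \<nu> \<and> singular_to_class \<nu> minkowski_class"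
    if "0 < t" "t < 1" for t
    using that by (intro harmonic_measure_segment_interior[of "1 - t"]) auto
  with supp nd harmonic_measure_segment_endpoint[OF \<mu>(1)] harmonic_measure_segment_endpoint[OF \<mu>(2)]
  show ?thesis by blast
qed

end
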